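(* Let $M$ be a smooth manifold and let $R_d\colon U\subset TM\to M\times M$ be a discretization map on $M$. Then $R_d$ is a local diffeomorphism from some neighborhood of the zero section of $TM$.
   Context: Discretization map: let $M$ be a smooth manifold and $U\subset TM$ an open neighborhood of the zero section. A smooth map $R_d\colon U\to M\times M$, $R_d(x,v)=(R^1(x,v),R^2(x,v))$, is a discretization map on $M$ if (1) $R_d(x,0)=(x,x)$ for all $x\in M$; and (2) for every $x\in M$, $T_{0_x}R^2_x-T_{0_x}R^1_x\colon T_{0_x}T_xM\simeq T_xM\to T_xM$ is the identity map of $T_xM$, where $R^a_x$ is the restriction of $R^a$ to (the part in $U$ of) $T_xM$, $a=1,2$, and $0_x$ is the zero vector of $T_xM$. *)

theory Defs
  imports "HOL-Analysis.Analysis"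
begin

section \<open>Smooth maps between open subsets of Euclidean spaces\<close>

text \<open>
  The domain is meant to be finite-dimensional and \<open>S\<close> open. In finite dimension a map is
  \<open>C^(k+1)\<close> iff it is differentiable and all its directional derivatives are \<open>C^k\<close>.
\<close>

primrec Ck_on :: "nat \<Rightarrow> 'a::real_normed_vector set \<Rightarrow> ('a \<Rightarrow> 'b::real_normed_vector) \<Rightarrow> bool" where
  "Ck_on 0 S f = continuous_on S f"
| "Ck_on (Suc k) S f =
    ((\<forall>x\<in>S. f differentiable at x) \<and> (\<forall>v. Ck_on k S (\<lambda>x. frechet_derivative f (at x) v)))"

definition smooth_on :: "'a::real_normed_vector set \<Rightarrow> ('a \<Rightarrow> 'b::real_normed_vector) \<Rightarrow> bool" where
  "smooth_on S f \<longleftrightarrow> (\<forall>k. Ck_on k S f)"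

section \<open>Smooth manifolds\<close>

text \<open>
  A chart is a pair (domain, coordinate map); the coordinate map is irrelevant outside its domain.
  The model space \<open>'e\<close> is a real inner product space, required to be finite-dimensional in
  \<open>smooth_manifold\<close>. The class \<open>euclidean_space\<close> is not used because it excludes dimension 0.
\<close>

type_synonym ('a, 'e) chart = "'a set \<times> ('a \<Rightarrow> 'e)"

record ('a, 'e) manifold =
  mtop :: "'a topology"
  atlas :: "('a, 'e) chart set"

abbreviation points :: "('a, 'e) manifold \<Rightarrow> 'a set" where
  "points M \<equiv> topspace (mtop M)"

abbreviation dom_chart :: "('a, 'e) chart \<Rightarrow> 'a set" where
  "dom_chart c \<equiv> fst c"

abbreviation coord :: "('a, 'e) chart \<Rightarrow> 'a \<Rightarrow> 'e" where
  "coord c \<equiv> snd c"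

definition param :: "('a, 'e) chart \<Rightarrow> 'e \<Rightarrow> 'a" where
  "param c = inv_into (dom_chart c) (coord c)"

definition charts_at :: "('a, 'e) manifold \<Rightarrow> 'a \<Rightarrow> ('a, 'e) chart set" where
  "charts_at M p = {c \<in> atlas M. p \<in> dom_chart c}"

definition smooth_manifold :: "('a, 'e::real_inner) manifold \<Rightarrow> bool" where
  "smooth_manifold M \<longleftrightarrow>
     (\<exists>B::'e set. finite B \<and> span B = UNIV) \<and>
     Hausdorff_space (mtop M) \<and> second_countable (mtop M) \<and>
     (\<Union>c\<in>atlas M. dom_chart c) = points M \<and>
     (\<forall>c\<in>atlas M. openin (mtop M) (dom_chart c) \<and> open (coord c ` dom_chart c) \<and>
        homeomorphic_map (subtopology (mtop M) (dom_chart c))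
          (top_of_set (coord c ` dom_chart c)) (coord c)) \<and>
     (\<forall>c\<in>atlas M. \<forall>d\<in>atlas M.
        smooth_on (coord c ` (dom_chart c \<inter> dom_chart d)) (coord d \<circ> param c))"

definition atlas_topology :: "('a, 'e::topological_space) chart set \<Rightarrow> 'a topology" where
  "atlas_topology A =
     topology_generated_by {{p \<in> dom_chart c. coord c p \<in> W} |c W. c \<in> A \<and> open W}"

definition product_manifold :: "('a, 'e) manifold \<Rightarrow> ('b, 'f) manifold \<Rightarrow> ('a \<times> 'b, 'e \<times> 'f) manifold" where
  "product_manifold M N =
     \<lparr>mtop = prod_topology (mtop M) (mtop N),
      atlas = {(dom_chart c \<times> dom_chart d, map_prod (coord c) (coord d)) |c d.
                 c \<in> atlas M \<and> d \<in> atlas N}\<rparr>"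

definition smooth_map ::
    "('a, 'e::real_inner) manifold \<Rightarrow> ('b, 'f::real_inner) manifold \<Rightarrow> 'a set \<Rightarrow> ('a \<Rightarrow> 'b) \<Rightarrow> bool" where
  "smooth_map M N U F \<longleftrightarrow>
     openin (mtop M) U \<and> continuous_map (subtopology (mtop M) U) (mtop N) F \<and>
     (\<forall>c\<in>atlas M. \<forall>d\<in>atlas N.
        smooth_on (coord c ` {p \<in> U \<inter> dom_chart c. F p \<in> dom_chart d}) (coord d \<circ> F \<circ> param c))"

definition diffeomorphism_on ::
    "('a, 'e::real_inner) manifold \<Rightarrow> ('b, 'f::real_inner) manifold \<Rightarrow> 'a set \<Rightarrow> 'b set \<Rightarrow> ('a \<Rightarrow> 'b) \<Rightarrow> bool" where
  "diffeomorphism_on M N V W F \<longleftrightarrow>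
     bij_betw F V W \<and> smooth_map M N V F \<and> smooth_map N M W (inv_into V F)"

definition local_diffeomorphism_on ::
    "('a, 'e::real_inner) manifold \<Rightarrow> ('b, 'f::real_inner) manifold \<Rightarrow> 'a set \<Rightarrow> ('a \<Rightarrow> 'b) \<Rightarrow> bool" where
  "local_diffeomorphism_on M N S F \<longleftrightarrow>
     openin (mtop M) S \<and> (\<forall>p\<in>S. \<exists>V W. p \<in> V \<and> V \<subseteq> S \<and> diffeomorphism_on M N V W F)"

section \<open>Tangent spaces and the tangent bundle\<close>

text \<open>
  A tangent vector at \<open>p\<close> is the family of its coordinate representations in all charts at \<open>p\<close>,
  transforming by the derivatives of the transition maps. (This is the class of pairs
  (chart at \<open>p\<close>, vector) under the usual equivalence, described by its unique representative in
  each chart.) Components at charts not containing \<open>p\<close> are set to 0, so that families are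
  equal iff the tangent vectors are; the vector space operations are componentwise.
\<close>

type_synonym ('a, 'e) tvec = "('a, 'e) chart \<Rightarrow> 'e"

definition tangent_space :: "('a, 'e::real_inner) manifold \<Rightarrow> 'a \<Rightarrow> ('a, 'e) tvec set" where
  "tangent_space M p =
     {v. (\<forall>c\<in>charts_at M p. \<forall>d\<in>charts_at M p.
            v d = frechet_derivative (coord d \<circ> param c) (at (coord c p)) (v c)) \<and>
         (\<forall>c. c \<notin> charts_at M p \<longrightarrow> v c = 0)}"

definition zero_tvec :: "('a, 'e::real_inner) tvec" where
  "zero_tvec = (\<lambda>c. 0)"

definition tangent_bundle :: "('a, 'e::real_inner) manifold \<Rightarrow> ('a \<times> ('a, 'e) tvec, 'e \<times> 'e) manifold" where
  "tangent_bundle M =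
     (let A = {(Sigma (dom_chart c) (tangent_space M), \<lambda>(p, v). (coord c p, v c)) |c. c \<in> atlas M}
      in \<lparr>mtop = atlas_topology A, atlas = A\<rparr>)"

definition zero_section :: "('a, 'e::real_inner) manifold \<Rightarrow> ('a \<times> ('a, 'e) tvec) set" where
  "zero_section M = {(x, zero_tvec) |x. x \<in> points M}"

text \<open>
  The differential of \<open>F\<close> at \<open>p\<close>, applied to the tangent vector \<open>v\<close>. The chart \<open>c\<close> is an arbitrary
  chart at \<open>p\<close>; by the chain rule the result does not depend on it.
\<close>

definition tangent_map ::
    "('a, 'e::real_inner) manifold \<Rightarrow> ('b, 'f::real_inner) manifold \<Rightarrow> ('a \<Rightarrow> 'b) \<Rightarrow> 'a
       \<Rightarrow> ('a, 'e) tvec \<Rightarrow> ('b, 'f) tvec" where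
  "tangent_map M N F p v =
     (let c = (SOME c. c \<in> charts_at M p)
      in (\<lambda>d. if d \<in> charts_at N (F p)
               then frechet_derivative (coord d \<circ> F \<circ> param c) (at (coord c p)) (v c) else 0))"

text \<open>
  The vector space \<open>T\<^sub>xM\<close> as a manifold: its charts are the linear isomorphisms onto the model space
  given by the charts of \<open>M\<close> at \<open>x\<close>.
\<close>

definition tangent_space_manifold ::
    "('a, 'e::real_inner) manifold \<Rightarrow> 'a \<Rightarrow> (('a, 'e) tvec, 'e) manifold" where
  "tangent_space_manifold M x =
     (let A = {(tangent_space M x, \<lambda>v. v c) |c. c \<in> charts_at M x}
      in \<lparr>mtop = atlas_topology A, atlas = A\<rparr>)"

text \<open>
  The canonical identification of \<open>T\<^sub>xM\<close> with its own tangent space at the origin: \<open>v\<close> corresponds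
  to the velocity at \<open>t = 0\<close> of the curve \<open>t \<mapsto> t v\<close>.
\<close>

definition vec_to_tangent_at_zero ::
    "('a, 'e::real_inner) manifold \<Rightarrow> 'a \<Rightarrow> ('a, 'e) tvec \<Rightarrow> (('a, 'e) tvec, 'e) tvec" where
  "vec_to_tangent_at_zero M x v =
     (\<lambda>k. if k \<in> charts_at (tangent_space_manifold M x) zero_tvec
           then vector_derivative (\<lambda>t. coord k (\<lambda>c. t *\<^sub>R v c)) (at 0) else 0)"

section \<open>Discretization maps\<close>

definition discretization_map ::
    "('a, 'e::real_inner) manifold \<Rightarrow> ('a \<times> ('a, 'e) tvec) set
       \<Rightarrow> ('a \<times> ('a, 'e) tvec \<Rightarrow> 'a \<times> 'a) \<Rightarrow> bool" where
  "discretization_map M U R \<longleftrightarrow>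
     openin (mtop (tangent_bundle M)) U \<and> zero_section M \<subseteq> U \<and>
     smooth_map (tangent_bundle M) (product_manifold M M) U R \<and>
     (\<forall>x\<in>points M. R (x, zero_tvec) = (x, x)) \<and>
     (\<forall>x\<in>points M. \<forall>v\<in>tangent_space M x.
        let T\<^sub>0 = (\<lambda>f. tangent_map (tangent_space_manifold M x) M f zero_tvec
                        (vec_to_tangent_at_zero M x v))
        in (\<lambda>c. T\<^sub>0 (\<lambda>w. snd (R (x, w))) c - T\<^sub>0 (\<lambda>w. fst (R (x, w))) c) = v)"

end

theory Submission
  imports Defs
begin

text \<open>
  In the chart of \<open>TM\<close> induced by a chart \<open>c\<close> at \<open>x\<close>, the derivative of \<open>R\<^sub>d\<close> at the zero vector
  over \<open>x\<close> is determined by the two axioms: along the zero section \<open>R\<^sub>d\<close> is the diagonal, so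
  \<open>(h, 0)\<close> goes to \<open>(h, h)\<close>, and on the fibre \<open>(0, k)\<close> goes to \<open>(A k, A k + k)\<close> for some linear \<open>A\<close>.
  The map \<open>(h, k) \<mapsto> (h + A k, h + A k + k)\<close> has the inverse
  \<open>(a, b) \<mapsto> (a - A (b - a), b - a)\<close>, and the inverse function theorem gives a neighborhood of each
  point of the zero section on which \<open>R\<^sub>d\<close> is a diffeomorphism. The union of these neighborhoods
  is the required one.
\<close>

section \<open>Finite-dimensional inner product spaces\<close>

text \<open>Condition (2) fixes only the difference of the two fibre derivatives, so
  \<open>A\<close> remains unknown. In block form the derivative is ((I, A), (I, A + I));
  subtracting the first row from the second leaves a triangular matrix with identity diagonal, which
  is invertible for every \<open>A\<close>: k is read off as b - a, and then h as a - A k. The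
  obstacle is analytic. \<open>Ck_on\<close> speaks of directional derivatives in a fixed direction,
  so derivatives are never points of an operator space, and there is no smooth inversion map to
  compose with. The frame identity takes over this role: it reduces a claim about a linear map to
  its values at finitely many vectors. Smoothness of a local inverse then rests on smoothness of the
  pointwise inverses of the derivative, obtained by induction on the order. The conclusion is local,
  so the neighborhoods found at different points require no common injectivity.\<close>

text \<open>The library's finite-dimensional theory is tied to \<open>euclidean_space\<close>, which excludes
  dimension 0; here finite dimension is witnessed by a finite frame, which may be empty.\<close>

definition parseval_frame :: "'a::real_inner set \<Rightarrow> bool" where
  "parseval_frame B \<longleftrightarrow> finite B \<and> (\<forall>x. (\<Sum>b\<in>B. (x \<bullet> b) *\<^sub>R b) = x)"

lemma parseval_frame_sum: "parseval_frame B \<Longrightarrow> (\<Sum>b\<in>B. (x \<bullet> b) *\<^sub>R b) = x"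
  by (simp add: parseval_frame_def)

lemma parseval_frame_finite: "parseval_frame B \<Longrightarrow> finite B"
  by (simp add: parseval_frame_def)

text \<open>Gram-Schmidt followed by normalization: the residual of the expansion is orthogonal to a
  spanning set, hence to itself.\<close>

lemma parseval_frame_exists:
  fixes B :: "'a::real_inner set"
  assumes "finite B" and "span B = UNIV"
  obtains C :: "'a set" where "parseval_frame C"
proof -
  obtain C where C: "finite C" "span C = (UNIV::'a set)" "pairwise orthogonal C"
    using basis_orthogonal[OF assms(1)] assms(2) by metis
  \<comment> \<open>An orthogonal set may contain 0, which \<open>sgn\<close> cannot turn into a
    unit vector.\<close>
  define D where "D = sgn ` (C - {0})"
  have D: "finite D" using C(1) by (simp add: D_def)
  have D_norm: "b \<bullet> b = 1" if "b \<in> D" for b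
    using that by (auto simp: D_def dot_square_norm norm_sgn split: if_splits)
  have D_orth: "b \<bullet> c = 0" if "b \<in> D" "c \<in> D" "b \<noteq> c" for b c
  proof -
    obtain b' c' where "b' \<in> C" "b = sgn b'" "c' \<in> C" "c = sgn c'"
      using \<open>b \<in> D\<close> \<open>c \<in> D\<close> by (auto simp: D_def)
    moreover from this have "b' \<bullet> c' = 0"
      using C(3) \<open>b \<noteq> c\<close> unfolding pairwise_def orthogonal_def by metis
    ultimately show ?thesis by (simp add: sgn_div_norm)
  qed
  have "(\<Sum>b\<in>D. (x \<bullet> b) *\<^sub>R b) = x" for x
  proof -
    define y where "y = x - (\<Sum>b\<in>D. (x \<bullet> b) *\<^sub>R b)"
    have y_D: "y \<bullet> c = 0" if "c \<in> D" for c
    proof -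
      have "(\<Sum>b\<in>D. (x \<bullet> b) *\<^sub>R b) \<bullet> c = (\<Sum>b\<in>D. (x \<bullet> b) * (b \<bullet> c))"
        by (simp add: inner_sum_left)
      also have "\<dots> = (\<Sum>b\<in>D. if b = c then x \<bullet> c else 0)"
        by (rule sum.cong) (auto simp: D_norm D_orth that)
      also have "\<dots> = x \<bullet> c" using D that by simp
      finally show ?thesis by (simp add: y_def inner_diff_left)
    qed
    have "orthogonal y c" if "c \<in> C" for c
    proof (cases "c = 0")
      case False
      then have "y \<bullet> sgn c = 0" using that by (intro y_D) (auto simp: D_def)
      then show ?thesis using False by (simp add: orthogonal_def sgn_div_norm)
    qed (simp add: orthogonal_def)
    then have "orthogonal y y"
      using orthogonal_to_span[of y C] C(2) by auto
    then show ?thesis by (simp add: orthogonal_def y_def)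
  qed
  then show thesis using that[of D] D by (simp add: parseval_frame_def)
qed

lemma parseval_frame_Times:
  fixes B :: "'a::real_inner set" and C :: "'b::real_inner set"
  assumes "parseval_frame B" and "parseval_frame C"
  shows "\<exists>D::('a \<times> 'b) set. parseval_frame D"
proof
  \<comment> \<open>A frame may contain 0, and then (0, 0) would lie in both families. Dropping it
    from the first changes no sum and makes \<open>D1\<close> and \<open>D2\<close> disjoint, so
    that the sum over the union splits.\<close>
  define D1 D2 where "D1 = (\<lambda>b. (b, 0::'b)) ` (B - {0})" and "D2 = (\<lambda>c. (0::'a, c)) ` C"
  note fin = parseval_frame_finite[OF assms(1)] parseval_frame_finite[OF assms(2)]
  have "(\<Sum>d\<in>D1. (x \<bullet> d) *\<^sub>R d) = (fst x, 0)" for x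
  proof -
    have "(\<Sum>d\<in>D1. (x \<bullet> d) *\<^sub>R d) = (\<Sum>b\<in>B - {0}. (x \<bullet> (b, 0)) *\<^sub>R (b, 0::'b))"
      unfolding D1_def by (subst sum.reindex) (auto simp: inj_on_def)
    also have "\<dots> = (\<Sum>b\<in>B. (x \<bullet> (b, 0)) *\<^sub>R (b, 0::'b))"
      by (rule sum.mono_neutral_left) (use fin in \<open>auto simp: zero_prod_def\<close>)
    also have "\<dots> = (\<Sum>b\<in>B. ((fst x \<bullet> b) *\<^sub>R b, 0))"
      by (intro sum.cong) (auto simp: inner_prod_def)
    also have "\<dots> = (fst x, 0)"
      using parseval_frame_sum[OF assms(1), of "fst x"] by (simp add: prod_eq_iff fst_sum snd_sum)
    finally show ?thesis .
  qed
  moreover have "(\<Sum>d\<in>D2. (x \<bullet> d) *\<^sub>R d) = (0, snd x)" for x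
  proof -
    have "(\<Sum>d\<in>D2. (x \<bullet> d) *\<^sub>R d) = (\<Sum>c\<in>C. (x \<bullet> (0, c)) *\<^sub>R (0::'a, c))"
      unfolding D2_def by (subst sum.reindex) (auto simp: inj_on_def)
    also have "\<dots> = (\<Sum>c\<in>C. (0, (snd x \<bullet> c) *\<^sub>R c))"
      by (intro sum.cong) (auto simp: inner_prod_def)
    also have "\<dots> = (0, snd x)"
      using parseval_frame_sum[OF assms(2), of "snd x"] by (simp add: prod_eq_iff fst_sum snd_sum)
    finally show ?thesis .
  qed
  moreover have "D1 \<inter> D2 = {}" by (auto simp: D1_def D2_def)
  moreover have "finite D1" "finite D2" using fin by (auto simp: D1_def D2_def)
  ultimately show "parseval_frame (D1 \<union> D2)"
    by (simp add: parseval_frame_def sum.union_disjoint)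
qed

lemma linear_parseval_frame:
  fixes f :: "'a::real_inner \<Rightarrow> 'b::real_normed_vector"
  assumes "parseval_frame (B::'a set)" and "linear f"
  shows "f x = (\<Sum>b\<in>B. (x \<bullet> b) *\<^sub>R f b)"
proof -
  have "f x = f (\<Sum>b\<in>B. (x \<bullet> b) *\<^sub>R b)"
    by (simp add: parseval_frame_sum[OF assms(1)])
  also have "\<dots> = (\<Sum>b\<in>B. (x \<bullet> b) *\<^sub>R f b)"
    by (simp add: linear_sum[OF assms(2)] linear_scale[OF assms(2)])
  finally show ?thesis .
qed

lemma bounded_linear_parseval_frame:
  fixes f :: "'a::real_inner \<Rightarrow> 'b::real_normed_vector"
  assumes "parseval_frame (B::'a set)" and "linear f"
  shows "bounded_linear f"
proof -
  have "bounded_linear (\<lambda>x. \<Sum>b\<in>B. (x \<bullet> b) *\<^sub>R f b)"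
    by (intro bounded_linear_sum bounded_linear_scaleR_left[THEN bounded_linear_compose]
        bounded_linear_inner_left)
  moreover have "f = (\<lambda>x. \<Sum>b\<in>B. (x \<bullet> b) *\<^sub>R f b)"
    by (rule ext) (rule linear_parseval_frame[OF assms])
  ultimately show ?thesis by simp
qed

text \<open>Cauchy sequences converge coordinate by coordinate, and the frame reassembles the
  limits. This supplies the complete closed balls for the Banach fixed point theorem.\<close>

lemma complete_parseval_frame:
  fixes S :: "'a::real_inner set"
  assumes B: "parseval_frame (B::'a set)" and "closed S"
  shows "complete S"
  unfolding complete_def
proof (intro allI impI)
  fix X assume X: "(\<forall>n. X n \<in> S) \<and> Cauchy X"
  have "convergent (\<lambda>n. X n \<bullet> b)" for b
    using X bounded_linear.Cauchy[OF bounded_linear_inner_left[of b]] Cauchy_convergent by auto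
  then have "\<exists>l. \<forall>b. (\<lambda>n. X n \<bullet> b) \<longlonglongrightarrow> l b"
    unfolding convergent_def by metis
  then obtain l where l: "\<And>b. (\<lambda>n. X n \<bullet> b) \<longlonglongrightarrow> l b" by blast
  have "(\<lambda>n. \<Sum>b\<in>B. (X n \<bullet> b) *\<^sub>R b) \<longlonglongrightarrow> (\<Sum>b\<in>B. l b *\<^sub>R b)"
    by (intro tendsto_sum tendsto_scaleR l tendsto_const)
  then have "X \<longlonglongrightarrow> (\<Sum>b\<in>B. l b *\<^sub>R b)"
    by (simp add: parseval_frame_sum[OF B])
  then show "\<exists>l\<in>S. X \<longlonglongrightarrow> l"
    using X \<open>closed S\<close> closed_sequentially by blast
qed

section \<open>Calculus of \<open>C\<^sup>k\<close> maps\<close>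

lemma Ck_on_subset: "Ck_on k S f \<Longrightarrow> T \<subseteq> S \<Longrightarrow> Ck_on k T f"
proof (induction k arbitrary: f)
  case 0 then show ?case by (auto intro: continuous_on_subset)
next
  case (Suc k) then show ?case by auto
qed

text \<open>Coordinate expressions such as \<open>coord d \<circ> param c\<close> are meaningful
  only on a chart image. On an open set, agreement of values passes to the derivatives of all
  orders.\<close>

lemma Ck_on_cong:
  assumes "open S" and "\<And>x. x \<in> S \<Longrightarrow> f x = g x"
  shows "Ck_on k S f \<longleftrightarrow> Ck_on k S g"
  using assms(2)
proof (induction k arbitrary: f g)
  case 0 then show ?case by (auto cong: continuous_on_cong)
next
  case (Suc k)
  have *: "(f has_derivative D) (at x) \<longleftrightarrow> (g has_derivative D) (at x)" if "x \<in> S" for x D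
    using that Suc.prems \<open>open S\<close> by (metis has_derivative_transform_within_open)
  then have "f differentiable at x \<longleftrightarrow> g differentiable at x" if "x \<in> S" for x
    using that by (auto simp: differentiable_def)
  moreover have "frechet_derivative f (at x) v = frechet_derivative g (at x) v" if "x \<in> S" for x v
    using * that by (simp add: frechet_derivative_def)
  then have "Ck_on k S (\<lambda>x. frechet_derivative f (at x) v) \<longleftrightarrow>
      Ck_on k S (\<lambda>x. frechet_derivative g (at x) v)" for v
    by (intro Suc.IH) auto
  ultimately show ?case by simp
qed

lemma Ck_on_SucD: "Ck_on (Suc k) S f \<Longrightarrow> Ck_on k S f"
proof (induction k arbitrary: f)
  case 0
  then show ?case
    by (auto intro!: continuous_at_imp_continuous_on differentiable_imp_continuous_within)
qed auto

text \<open>Admits an explicit derivative \<open>f'\<close> in place of the choice-based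
  \<open>frechet_derivative\<close>; the closure rules below rest on it.\<close>

lemma Ck_on_SucI:
  assumes "open S" and D: "\<And>x. x \<in> S \<Longrightarrow> (f has_derivative f' x) (at x)"
    and "\<And>v. Ck_on k S (\<lambda>x. f' x v)"
  shows "Ck_on (Suc k) S f"
proof -
  have "Ck_on k S (\<lambda>x. frechet_derivative f (at x) v)" for v
    using assms(3)[of v] frechet_derivative_at[OF D]
    by (subst Ck_on_cong[OF \<open>open S\<close>, where g = "\<lambda>x. f' x v"]) (auto dest: fun_cong)
  then show ?thesis using D by (auto simp: differentiable_def)
qed

lemma Ck_on_Suc_has_derivative:
  "Ck_on (Suc k) S f \<Longrightarrow> x \<in> S \<Longrightarrow> (f has_derivative frechet_derivative f (at x)) (at x)"
  by (simp add: frechet_derivative_works)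

lemma Ck_on_const: "open S \<Longrightarrow> Ck_on k S (\<lambda>x. c)"
proof (induction k arbitrary: c)
  case (Suc k)
  then show ?case by (intro Ck_on_SucI[OF _ has_derivative_const]) auto
qed simp

lemma Ck_on_bounded_linear_compose:
  assumes "open S" and "bounded_linear h" and "Ck_on k S f"
  shows "Ck_on k S (\<lambda>x. h (f x))"
  using assms(3)
proof (induction k arbitrary: f)
  case 0
  then show ?case using assms(2) by (simp add: bounded_linear.continuous_on)
next
  case (Suc k)
  show ?case
    by (rule Ck_on_SucI[OF \<open>open S\<close> bounded_linear.has_derivative[OF assms(2)]])
      (use Suc in \<open>auto intro: Ck_on_Suc_has_derivative simp: frechet_derivative_works\<close>)
qed

lemma Ck_on_ident:
  assumes "open S"
  shows "Ck_on k S (\<lambda>x. x)"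
proof (cases k)
  case (Suc n)
  then show ?thesis
    using Ck_on_SucI[OF assms has_derivative_ident] Ck_on_const[OF assms] by metis
qed simp

lemma Ck_on_add:
  assumes "open S" and "Ck_on k S f" and "Ck_on k S g"
  shows "Ck_on k S (\<lambda>x. f x + g x)"
  using assms(2,3)
proof (induction k arbitrary: f g)
  case 0 then show ?case by (simp add: continuous_on_add)
next
  case (Suc k)
  show ?case
    by (rule Ck_on_SucI[OF \<open>open S\<close> has_derivative_add])
      (use Suc in \<open>auto simp: frechet_derivative_works\<close>)
qed

lemma Ck_on_sum:
  assumes "open S" and "\<And>i. i \<in> I \<Longrightarrow> Ck_on k S (f i)"
  shows "Ck_on k S (\<lambda>x. \<Sum>i\<in>I. f i x)"
  using assms(2) by (induction I rule: infinite_finite_induct) (auto intro: Ck_on_const Ck_on_add assms(1))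

lemma Ck_on_scaleR:
  assumes "open S" and "Ck_on k S f" and "Ck_on k S g"
  shows "Ck_on k S (\<lambda>x. f x *\<^sub>R g x)"
  using assms(2,3)
proof (induction k arbitrary: f g)
  case 0 then show ?case by (simp add: continuous_on_scaleR)
next
  case (Suc k)
  show ?case
  proof (rule Ck_on_SucI[OF \<open>open S\<close> has_derivative_scaleR])
    fix v
    show "Ck_on k S (\<lambda>x. f x *\<^sub>R frechet_derivative g (at x) v + frechet_derivative f (at x) v *\<^sub>R g x)"
      using Suc.prems Suc.prems[THEN Ck_on_SucD] by (auto intro!: Ck_on_add \<open>open S\<close> Suc.IH)
  qed (use Suc.prems in \<open>auto simp: frechet_derivative_works\<close>)
qed

lemma Ck_on_Pair:
  assumes "open S" and "Ck_on k S f" and "Ck_on k S g"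
  shows "Ck_on k S (\<lambda>x. (f x, g x))"
  using assms(2,3)
proof (induction k arbitrary: f g)
  case 0 then show ?case by (simp add: continuous_on_Pair)
next
  case (Suc k)
  show ?case
    by (rule Ck_on_SucI[OF \<open>open S\<close> has_derivative_Pair])
      (use Suc in \<open>auto simp: frechet_derivative_works\<close>)
qed

text \<open>Expanding the inner derivative in a frame of the intermediate space turns the chain rule
  into a finite sum of products, so no operator-valued \<open>C\<^sup>k\<close> maps are needed.\<close>

lemma Ck_on_compose:
  assumes B: "parseval_frame (B::'b::real_inner set)" and "open S"
    and f: "Ck_on k T f" and g: "Ck_on k S (g::'a::real_normed_vector \<Rightarrow> 'b)"
    and gS: "g ` S \<subseteq> T"
  shows "Ck_on k S (\<lambda>x. f (g x))"
  using f g
proof (induction k arbitrary: f)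
  case 0
  then show ?case using gS by (auto intro: continuous_on_compose2)
next
  case (Suc k)
  define Df Dg where "Df = (\<lambda>y. frechet_derivative f (at y))" and "Dg = (\<lambda>x. frechet_derivative g (at x))"
  have Df: "(f has_derivative Df (g x)) (at (g x))" if "x \<in> S" for x
    using that Suc.prems(1) gS unfolding Df_def by (intro Ck_on_Suc_has_derivative) auto
  have Dg: "(g has_derivative Dg x) (at x)" if "x \<in> S" for x
    using that Suc.prems(2) unfolding Dg_def by (intro Ck_on_Suc_has_derivative) auto
  show ?case
  proof (rule Ck_on_SucI[OF \<open>open S\<close>])
    fix x assume x: "x \<in> S"
    have "linear (Df (g x))" using Df[OF x] has_derivative_linear by blast
    then have "Df (g x) \<circ> Dg x = (\<lambda>v. \<Sum>b\<in>B. (Dg x v \<bullet> b) *\<^sub>R Df (g x) b)"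
      using linear_parseval_frame[OF B] by (auto simp: fun_eq_iff)
    then show "((\<lambda>x. f (g x)) has_derivative (\<lambda>v. \<Sum>b\<in>B. (Dg x v \<bullet> b) *\<^sub>R Df (g x) b)) (at x)"
      using diff_chain_at[OF Dg[OF x] Df[OF x]] by (simp add: o_def)
  next
    fix v
    have "Ck_on k S (\<lambda>x. Df (g x) b)" for b
      using Suc.prems unfolding Df_def by (intro Suc.IH) (auto intro: Ck_on_SucD)
    then show "Ck_on k S (\<lambda>x. \<Sum>b\<in>B. (Dg x v \<bullet> b) *\<^sub>R Df (g x) b)"
      using Suc.prems(2) unfolding Dg_def
      by (intro Ck_on_sum Ck_on_scaleR \<open>open S\<close>
          Ck_on_bounded_linear_compose[OF _ bounded_linear_inner_left]) auto
  qed
qed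

section \<open>Smooth maps: the rules for every order at once\<close>

lemma smooth_on_imp_has_derivative:
  "smooth_on S f \<Longrightarrow> x \<in> S \<Longrightarrow> (f has_derivative frechet_derivative f (at x)) (at x)"
  using Ck_on_Suc_has_derivative unfolding smooth_on_def by blast

lemma smooth_on_frechet_derivative:
  "smooth_on S f \<Longrightarrow> smooth_on S (\<lambda>x. frechet_derivative f (at x) v)"
  unfolding smooth_on_def using Ck_on.simps(2) by blast

lemma smooth_on_imp_continuous_on: "smooth_on S f \<Longrightarrow> continuous_on S f"
  unfolding smooth_on_def using Ck_on.simps(1) by blast

lemma smooth_on_subset: "smooth_on S f \<Longrightarrow> T \<subseteq> S \<Longrightarrow> smooth_on T f"
  unfolding smooth_on_def using Ck_on_subset by blast

lemma smooth_on_cong: "open S \<Longrightarrow> (\<And>x. x \<in> S \<Longrightarrow> f x = g x) \<Longrightarrow> smooth_on S f \<longleftrightarrow> smooth_on S g"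
  unfolding smooth_on_def using Ck_on_cong by blast

lemma smooth_on_bounded_linear: "open S \<Longrightarrow> bounded_linear h \<Longrightarrow> smooth_on S h"
  unfolding smooth_on_def using Ck_on_bounded_linear_compose[OF _ _ Ck_on_ident] by blast

lemma smooth_on_sum:
  "open S \<Longrightarrow> (\<And>i. i \<in> I \<Longrightarrow> smooth_on S (f i)) \<Longrightarrow> smooth_on S (\<lambda>x. \<Sum>i\<in>I. f i x)"
  unfolding smooth_on_def by (blast intro: Ck_on_sum)

lemma smooth_on_scaleR:
  "open S \<Longrightarrow> smooth_on S f \<Longrightarrow> smooth_on S g \<Longrightarrow> smooth_on S (\<lambda>x. f x *\<^sub>R g x)"
  unfolding smooth_on_def using Ck_on_scaleR by blast

lemma smooth_on_Pair:
  "open S \<Longrightarrow> smooth_on S f \<Longrightarrow> smooth_on S g \<Longrightarrow> smooth_on S (\<lambda>x. (f x, g x))"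
  unfolding smooth_on_def using Ck_on_Pair by blast

lemma smooth_on_compose:
  "parseval_frame (B::'b::real_inner set) \<Longrightarrow> open S \<Longrightarrow> smooth_on T f \<Longrightarrow>
    smooth_on S (g::'a::real_normed_vector \<Rightarrow> 'b) \<Longrightarrow> g ` S \<subseteq> T \<Longrightarrow> smooth_on S (\<lambda>x. f (g x))"
  unfolding smooth_on_def using Ck_on_compose by blast

section \<open>The inverse function theorem\<close>

text \<open>Expanding v in the frame bounds the error at v by norm v times a finite sum of errors at
  frame vectors. Pointwise convergence of linear maps thus becomes convergence in operator
  norm.\<close>

lemma eventually_operator_close:
  fixes A :: "'x \<Rightarrow> 'a::real_inner \<Rightarrow> 'b::real_normed_vector"
  assumes B: "parseval_frame (B::'a set)" and lim: "\<And>v. ((\<lambda>x. A x v) \<longlongrightarrow> A0 v) F"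
    and lin: "\<forall>\<^sub>F x in F. linear (A x)" and "linear A0" and "e > 0"
  shows "\<forall>\<^sub>F x in F. \<forall>v. norm (A x v - A0 v) \<le> e * norm v"
proof -
  have "((\<lambda>x. \<Sum>b\<in>B. norm b * norm (A x b - A0 b)) \<longlongrightarrow> (\<Sum>b\<in>B. norm b * norm (A0 b - A0 b))) F"
    by (intro tendsto_intros lim)
  then have "\<forall>\<^sub>F x in F. (\<Sum>b\<in>B. norm b * norm (A x b - A0 b)) < e"
    using \<open>e > 0\<close> order_tendstoD(2) by force
  with lin show ?thesis
  proof eventually_elim
    fix x assume "linear (A x)" and less: "(\<Sum>b\<in>B. norm b * norm (A x b - A0 b)) < e"
    show "\<forall>v. norm (A x v - A0 v) \<le> e * norm v"
    proof
      fix v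
      have "linear (\<lambda>v. A x v - A0 v)"
        by (intro linear_compose_sub) fact+
      then have "norm (A x v - A0 v) = norm (\<Sum>b\<in>B. (v \<bullet> b) *\<^sub>R (A x b - A0 b))"
        using linear_parseval_frame[OF B] by metis
      also have "\<dots> \<le> (\<Sum>b\<in>B. norm ((v \<bullet> b) *\<^sub>R (A x b - A0 b)))"
        by (rule norm_sum)
      also have "\<dots> \<le> (\<Sum>b\<in>B. (norm v * norm b) * norm (A x b - A0 b))"
        by (intro sum_mono) (simp add: mult_right_mono Cauchy_Schwarz_ineq2)
      also have "\<dots> = (\<Sum>b\<in>B. norm b * norm (A x b - A0 b)) * norm v"
        by (simp add: sum_distrib_left mult_ac)
      also have "\<dots> \<le> e * norm v"
        using less by (intro mult_right_mono) auto
      finally show "norm (A x v - A0 v) \<le> e * norm v" .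
    qed
  qed
qed

section \<open>Pointwise inverses of a family of linear maps\<close>

text \<open>The term of the product rule that would differentiate \<open>a\<close> carries the
  factor \<open>\<psi> x = 0\<close>, so continuity of \<open>a\<close> is enough. It is applied
  with \<open>a\<close> a map \<open>\<lambda>x. L x c\<close>, whose differentiability is just what
  is being proved.\<close>

lemma has_derivative_scaleR_vanishing:
  fixes \<psi> :: "'a::real_normed_vector \<Rightarrow> real" and a :: "'a \<Rightarrow> 'b::real_normed_vector"
  assumes \<psi>: "(\<psi> has_derivative \<psi>') (at x)" and "\<psi> x = 0" and a: "isCont a x"
  shows "((\<lambda>y. \<psi> y *\<^sub>R a y) has_derivative (\<lambda>h. \<psi>' h *\<^sub>R a x)) (at x)"
proof -
  have bl: "bounded_linear \<psi>'"
    and lim: "((\<lambda>y. norm (\<psi> y - \<psi> x - \<psi>' (y - x)) / norm (y - x)) \<longlongrightarrow> 0) (at x)"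
    using \<psi> by (auto simp: has_derivative_iff_norm)
  obtain K where K: "\<And>h. norm (\<psi>' h) \<le> norm h * K"
    using bl bounded_linear.bounded by blast
  have bound: "norm (\<psi> y *\<^sub>R a y - \<psi> x *\<^sub>R a x - \<psi>' (y - x) *\<^sub>R a x) / norm (y - x)
      \<le> norm (\<psi> y - \<psi> x - \<psi>' (y - x)) / norm (y - x) * norm (a y) + K * norm (a y - a x)"
    if "y \<noteq> x" for y
  proof -
    \<comment> \<open>The remainder splits into the remainder of \<open>\<psi>\<close> scaled by
      \<open>a y\<close>, and a term of first order times the increment of \<open>a\<close>, which
      tends to 0 by continuity.\<close>
    have "\<psi> y *\<^sub>R a y - \<psi> x *\<^sub>R a x - \<psi>' (y - x) *\<^sub>R a x
        = (\<psi> y - \<psi> x - \<psi>' (y - x)) *\<^sub>R a y + \<psi>' (y - x) *\<^sub>R (a y - a x)"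
      using \<open>\<psi> x = 0\<close> by (simp add: algebra_simps)
    then have "norm (\<psi> y *\<^sub>R a y - \<psi> x *\<^sub>R a x - \<psi>' (y - x) *\<^sub>R a x)
        \<le> norm (\<psi> y - \<psi> x - \<psi>' (y - x)) * norm (a y) + norm (\<psi>' (y - x)) * norm (a y - a x)"
      by (metis norm_triangle_ineq norm_scaleR real_norm_def)
    also have "\<dots> \<le> norm (\<psi> y - \<psi> x - \<psi>' (y - x)) * norm (a y) + (norm (y - x) * K) * norm (a y - a x)"
      by (intro add_left_mono mult_right_mono K) auto
    finally have "norm (\<psi> y *\<^sub>R a y - \<psi> x *\<^sub>R a x - \<psi>' (y - x) *\<^sub>R a x) / norm (y - x)
        \<le> (norm (\<psi> y - \<psi> x - \<psi>' (y - x)) * norm (a y) + (norm (y - x) * K) * norm (a y - a x))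
          / norm (y - x)"
      by (rule divide_right_mono) simp
    also have "\<dots> = norm (\<psi> y - \<psi> x - \<psi>' (y - x)) / norm (y - x) * norm (a y) + K * norm (a y - a x)"
      using that by (simp add: add_divide_distrib)
    finally show ?thesis .
  qed
  have "((\<lambda>y. norm (\<psi> y - \<psi> x - \<psi>' (y - x)) / norm (y - x) * norm (a y) + K * norm (a y - a x))
      \<longlongrightarrow> 0 * norm (a x) + K * norm (a x - a x)) (at x)"
    using a unfolding isCont_def by (intro tendsto_intros lim)
  then have "((\<lambda>y. norm (\<psi> y - \<psi> x - \<psi>' (y - x)) / norm (y - x) * norm (a y) + K * norm (a y - a x))
      \<longlongrightarrow> 0) (at x)"
    by simp
  then have "((\<lambda>y. norm (\<psi> y *\<^sub>R a y - \<psi> x *\<^sub>R a x - \<psi>' (y - x) *\<^sub>R a x) / norm (y - x)) \<longlongrightarrow> 0) (at x)"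
  proof (rule Lim_null_comparison[rotated])
    show "\<forall>\<^sub>F y in at x. norm (norm (\<psi> y *\<^sub>R a y - \<psi> x *\<^sub>R a x - \<psi>' (y - x) *\<^sub>R a x) / norm (y - x))
        \<le> norm (\<psi> y - \<psi> x - \<psi>' (y - x)) / norm (y - x) * norm (a y) + K * norm (a y - a x)"
      unfolding eventually_at_filter using bound by (auto intro!: always_eventually)
  qed
  then show ?thesis
    using bl by (simp add: has_derivative_iff_norm bounded_linear_scaleR_const)
qed

text \<open>The derivative of \<open>x \<mapsto> L x v\<close> comes from
  \<open>L x v - L x\<^sub>0 v = L x (v - A x (L x\<^sub>0 v))\<close>, expanded in a frame: it is again a combination of
  the maps \<open>x \<mapsto> L x c\<close>, which is what the induction on \<open>k\<close> needs.\<close>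

lemma Ck_on_inverse_family:
  fixes A :: "'x::real_normed_vector \<Rightarrow> 'b::real_inner \<Rightarrow> 'c::real_inner"
    and L :: "'x \<Rightarrow> 'c \<Rightarrow> 'b"
  assumes B: "parseval_frame (B::'b set)" and C: "parseval_frame (C::'c set)" and S: "open S"
    and linA: "\<And>x. x \<in> S \<Longrightarrow> linear (A x)" and linL: "\<And>x. x \<in> S \<Longrightarrow> linear (L x)"
    and LA: "\<And>x v. x \<in> S \<Longrightarrow> L x (A x v) = v" and AL: "\<And>x v. x \<in> S \<Longrightarrow> A x (L x v) = v"
    and K: "\<And>x v. x \<in> S \<Longrightarrow> norm (L x v) \<le> K * norm v"
    and "\<And>v. Ck_on k S (\<lambda>x. A x v)"
  shows "Ck_on k S (\<lambda>x. L x v)"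
  using assms(9)
proof (induction k arbitrary: v)
  have diff: "L x v - L x0 v = L x (v - A x (L x0 v))" if "x \<in> S" for x x0 v
    using linL[OF that] LA[OF that] by (simp add: linear_diff)
  {
    case 0
    have "isCont (\<lambda>x. L x v) x0" if "x0 \<in> S" for x0
    proof -
      have "((\<lambda>x. A x (L x0 v)) \<longlongrightarrow> A x0 (L x0 v)) (at x0)"
        using 0 that S by (auto simp: continuous_on_eq_continuous_at isCont_def)
      then have "((\<lambda>x. K * norm (v - A x (L x0 v))) \<longlongrightarrow> K * norm (v - A x0 (L x0 v))) (at x0)"
        by (intro tendsto_intros)
      then have "((\<lambda>x. K * norm (v - A x (L x0 v))) \<longlongrightarrow> 0) (at x0)"
        using AL that by simp
      moreover have "\<forall>\<^sub>F x in at x0. norm (L x v - L x0 v) \<le> K * norm (v - A x (L x0 v))"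
        using eventually_at_in_open'[OF S that] by eventually_elim (simp add: diff K)
      ultimately have "((\<lambda>x. L x v - L x0 v) \<longlongrightarrow> 0) (at x0)"
        by (rule Lim_null_comparison[rotated])
      then show ?thesis by (simp add: isCont_def LIM_zero_iff)
    qed
    then show ?case by (auto intro: continuous_at_imp_continuous_on)
  next
    case (Suc k)
    define D where "D = (\<lambda>b x. frechet_derivative (\<lambda>x. A x b) (at x))"
    \<comment> \<open>The classical derivative of an inverse, - L (DA h) L, applied to v: the inner
      map is expanded in \<open>B\<close>, the outer one in \<open>C\<close>. Every factor that
      results is known to be of class \<open>Ck_on k\<close>.\<close>
    define L' where "L' = (\<lambda>x h. \<Sum>c\<in>C. (- ((\<Sum>b\<in>B. (L x v \<bullet> b) *\<^sub>R D b x h) \<bullet> c)) *\<^sub>R L x c)"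
    have Ck_L: "Ck_on k S (\<lambda>x. L x v)" for v
      using Suc Ck_on_SucD by blast
    then have cont_L: "isCont (\<lambda>x. L x v) x" if "x \<in> S" for x v
    proof -
      have "Ck_on 0 S (\<lambda>x. L x v)"
        using Ck_L[of v] by (induction k) (auto dest: Ck_on_SucD simp del: Ck_on.simps)
      then show ?thesis using that S by (auto simp: continuous_on_eq_continuous_at)
    qed
    have D: "((\<lambda>x. A x w) has_derivative (\<lambda>h. \<Sum>b\<in>B. (w \<bullet> b) *\<^sub>R D b x h)) (at x)" if "x \<in> S" for w x
    proof (rule has_derivative_transform_within_open[OF _ S that])
      show "((\<lambda>x. \<Sum>b\<in>B. (w \<bullet> b) *\<^sub>R A x b) has_derivative (\<lambda>h. \<Sum>b\<in>B. (w \<bullet> b) *\<^sub>R D b x h)) (at x)"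
        unfolding D_def using Suc.prems that
        by (intro has_derivative_sum has_derivative_scaleR_right Ck_on_Suc_has_derivative)
    qed (use linear_parseval_frame[OF B] linA in metis)
    show ?case
    proof (rule Ck_on_SucI[OF S, where f' = L'])
      fix x0 assume x0: "x0 \<in> S"
      define w0 where "w0 = L x0 v"
      \<comment> \<open>This is the frame expansion of \<open>L x v\<close> with \<open>w0\<close>
        frozen at \<open>x0\<close>. Its scalar coefficients vanish at \<open>x0\<close>, so the
        product rule with a merely continuous factor applies.\<close>
      have "((\<lambda>x. w0 + (\<Sum>c\<in>C. ((v - A x w0) \<bullet> c) *\<^sub>R L x c)) has_derivative
          (\<lambda>h. 0 + (\<Sum>c\<in>C. ((0 - (\<Sum>b\<in>B. (w0 \<bullet> b) *\<^sub>R D b x0 h)) \<bullet> c) *\<^sub>R L x0 c))) (at x0)"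
        by (intro has_derivative_add has_derivative_const has_derivative_sum
            has_derivative_scaleR_vanishing has_derivative_inner_left has_derivative_diff D x0 cont_L)
          (simp add: w0_def AL x0)
      then have "((\<lambda>x. w0 + (\<Sum>c\<in>C. ((v - A x w0) \<bullet> c) *\<^sub>R L x c)) has_derivative L' x0) (at x0)"
        by (simp add: L'_def w0_def)
      moreover have "w0 + (\<Sum>c\<in>C. ((v - A x w0) \<bullet> c) *\<^sub>R L x c) = L x v" if "x \<in> S" for x
        using diff[OF that, of v x0] linear_parseval_frame[OF C linL[OF that], of "v - A x w0"]
        by (simp add: w0_def algebra_simps)
      ultimately show "((\<lambda>x. L x v) has_derivative L' x0) (at x0)"
        by (rule has_derivative_transform_within_open[OF _ S x0])
    next
      fix h
      have "Ck_on k S (\<lambda>x. D b x h)" for b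
        using Suc.prems[of b] by (simp add: D_def)
      then have inner: "Ck_on k S (\<lambda>x. \<Sum>b\<in>B. (L x v \<bullet> b) *\<^sub>R D b x h)"
        by (intro Ck_on_sum Ck_on_scaleR S Ck_L Ck_on_bounded_linear_compose[OF S bounded_linear_inner_left])
      have "bounded_linear (\<lambda>z::'c. - (z \<bullet> c))" for c
        by (intro bounded_linear_minus bounded_linear_inner_left)
      then show "Ck_on k S (\<lambda>x. L' x h)"
        unfolding L'_def
        by (intro Ck_on_sum Ck_on_scaleR S Ck_L Ck_on_bounded_linear_compose[OF S _ inner])
    qed
  }
qed

text \<open>Newton's iteration with the derivative frozen at \<open>x0\<close> is a contraction near
  \<open>x0\<close>, which yields injectivity and open images. The inverse is then differentiable
  with derivative \<open>L (g y)\<close>, and its order of smoothness rises one step at a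
  time.\<close>

theorem smooth_inverse_function:
  fixes f :: "'a::real_inner \<Rightarrow> 'b::real_inner"
  assumes B: "parseval_frame (B::'a set)" and C: "parseval_frame (C::'b set)"
    and "open U" and x0: "x0 \<in> U" and f: "smooth_on U f" and f': "(f has_derivative f') (at x0)"
    and T: "bounded_linear T" and Tf': "\<And>v. T (f' v) = v" and f'T: "\<And>v. f' (T v) = v"
  obtains V where "open V" "x0 \<in> V" "V \<subseteq> U" "inj_on f V" "open (f ` V)"
    "smooth_on (f ` V) (inv_into V f)"
proof -
  interpret T: bounded_linear T by fact
  obtain K where "K > 0" and K: "\<And>v. norm (T v) \<le> norm v * K"
    using T.pos_bounded by blast
  define D where "D = (\<lambda>x. frechet_derivative f (at x))"
  have D: "(f has_derivative D x) (at x)" if "x \<in> U" for x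
    using smooth_on_imp_has_derivative[OF f that] by (simp add: D_def)
  have D0: "D x0 = f'"
    using frechet_derivative_at[OF f'] by (simp add: D_def)
  \<comment> \<open>The tolerance 1 / (2 * K) is what \<open>T\<close>, bounded by \<open>K\<close>,
    turns into the factor 1 / 2 of \<open>TD\<close>.\<close>
  have "\<forall>\<^sub>F x in nhds x0. \<forall>v. norm (D x v - f' v) \<le> 1 / (2 * K) * norm v"
  proof (rule eventually_operator_close[OF B])
    show "((\<lambda>x. D x v) \<longlongrightarrow> f' v) (nhds x0)" for v
    proof -
      have "continuous_on U (\<lambda>x. D x v)"
        unfolding D_def by (intro smooth_on_imp_continuous_on smooth_on_frechet_derivative f)
      then have "isCont (\<lambda>x. D x v) x0"
        using \<open>open U\<close> x0 by (simp add: continuous_on_eq_continuous_at)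
      then show ?thesis using tendsto_at_iff_tendsto_nhds[of "\<lambda>x. D x v" x0] by (simp add: isCont_def D0)
    qed
    show "\<forall>\<^sub>F x in nhds x0. linear (D x)"
      using eventually_nhds_in_open[OF \<open>open U\<close> x0]
      by eventually_elim (rule has_derivative_linear[OF D])
    show "linear f'" using f' has_derivative_linear by blast
  qed (use \<open>K > 0\<close> in auto)
  then have "\<forall>\<^sub>F x in nhds x0. x \<in> U \<and> (\<forall>v. norm (D x v - f' v) \<le> 1 / (2 * K) * norm v)"
    using eventually_nhds_in_open[OF \<open>open U\<close> x0] by eventually_elim auto
  then obtain r where "r > 0"
    and r: "\<And>x. dist x x0 < r \<Longrightarrow> x \<in> U \<and> (\<forall>v. norm (D x v - f' v) \<le> 1 / (2 * K) * norm v)"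
    unfolding eventually_nhds_metric by blast
  \<comment> \<open>A ball, because the mean value inequality for \<open>\<phi>\<close> requires a
    convex domain.\<close>
  define V where "V = ball x0 r"
  have V: "open V" "convex V" "x0 \<in> V" "V \<subseteq> U"
    using \<open>r > 0\<close> r by (auto simp: V_def dist_commute)
  have TD: "norm (v - T (D x v)) \<le> 1 / 2 * norm v" if "x \<in> V" for x v
  proof -
    have "v - T (D x v) = - T (D x v - f' v)" by (simp add: T.diff Tf')
    then have "norm (v - T (D x v)) \<le> norm (D x v - f' v) * K"
      using K by simp
    also have "\<dots> \<le> (1 / (2 * K) * norm v) * K"
      using r that \<open>K > 0\<close> by (intro mult_right_mono) (auto simp: V_def dist_commute)
    finally show ?thesis using \<open>K > 0\<close> by simp
  qed
  text \<open>\<open>\<phi>\<close> is a contraction on \<open>V\<close>, and the fixed points of \<open>x \<mapsto> \<phi> x + T y\<close> are the solutions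
    of \<open>f x = y\<close>.\<close>
  define \<phi> where "\<phi> = (\<lambda>x. x - T (f x))"
  have \<phi>: "norm (\<phi> x - \<phi> y) \<le> 1 / 2 * norm (x - y)" if "x \<in> V" "y \<in> V" for x y
  proof (rule differentiable_bound[OF \<open>convex V\<close> _ _ that])
    fix z assume z: "z \<in> V"
    have "(\<phi> has_derivative (\<lambda>v. v - T (D z v))) (at z)"
      unfolding \<phi>_def using z V
      by (intro has_derivative_diff has_derivative_ident T.has_derivative D) auto
    then show "(\<phi> has_derivative (\<lambda>v. v - T (D z v))) (at z within V)"
      by (rule has_derivative_at_withinI)
    show "onorm (\<lambda>v. v - T (D z v)) \<le> 1 / 2"
      using TD[OF z] by (intro onorm_bound) auto
  qed
  \<comment> \<open>As \<open>\<phi>\<close> keeps at most half of x - y, the other half must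
    survive in T (f x) - T (f y). Injectivity and the Lipschitz constant 2 * K of the inverse both
    come from this bound.\<close>
  have expand: "norm (x - y) \<le> 2 * norm (T (f x) - T (f y))" if "x \<in> V" "y \<in> V" for x y
  proof -
    have "x - y = (\<phi> x - \<phi> y) + (T (f x) - T (f y))" by (simp add: \<phi>_def)
    then have "norm (x - y) \<le> norm (\<phi> x - \<phi> y) + norm (T (f x) - T (f y))"
      by (metis norm_triangle_ineq)
    then show ?thesis using \<phi>[OF that] by simp
  qed
  have inj: "inj_on f V"
    using expand by (force intro: inj_onI)
  have open_map: "open (f ` W)" if "open W" "W \<subseteq> V" for W
  unfolding open_contains_ball
  proof
    fix y1 assume "y1 \<in> f ` W"
    then obtain x1 where x1: "x1 \<in> W" "y1 = f x1" by blast
    then obtain s where "s > 0" and s: "cball x1 s \<subseteq> W"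
      using \<open>open W\<close> open_contains_cball by blast
    have sV: "cball x1 s \<subseteq> V" using s \<open>W \<subseteq> V\<close> by blast
    \<comment> \<open>With radius s / (2 * K), replacing \<open>y1\<close> by \<open>y\<close> costs
      at most s / 2 under \<open>T\<close>; the contraction costs at most another s / 2, so the
      iteration maps \<open>cball x1 s\<close> into itself.\<close>
    have "y \<in> f ` W" if y: "y \<in> ball y1 (s / (2 * K))" for y
    proof -
      have Ty: "norm (T y - T y1) \<le> s / 2"
      proof -
        have "norm (T y - T y1) \<le> norm (y - y1) * K"
          using K[of "y - y1"] by (simp add: T.diff)
        also have "\<dots> \<le> (s / (2 * K)) * K"
          using y \<open>K > 0\<close> by (intro mult_right_mono) (auto simp: dist_norm norm_minus_commute)
        finally show ?thesis using \<open>K > 0\<close> by simp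
      qed
      have "\<exists>!x\<in>cball x1 s. \<phi> x + T y = x"
      proof (rule Banach_fix[where c = "1/2"])
        show "complete (cball x1 s)" by (rule complete_parseval_frame[OF B closed_cball])
        show "(\<lambda>x. \<phi> x + T y) ` cball x1 s \<subseteq> cball x1 s"
        proof safe
          fix x assume x: "x \<in> cball x1 s"
          have "x1 - (\<phi> x + T y) = (\<phi> x1 - \<phi> x) - (T y - T y1)"
            by (simp add: \<phi>_def x1)
          then have "norm (x1 - (\<phi> x + T y)) \<le> norm (\<phi> x1 - \<phi> x) + norm (T y - T y1)"
            by (metis norm_triangle_ineq4)
          also have "\<dots> \<le> 1 / 2 * norm (x1 - x) + s / 2"
            using x x1 sV \<open>W \<subseteq> V\<close> by (intro add_mono \<phi> Ty) blast+
          also have "\<dots> \<le> s" using x by (simp add: dist_norm)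
          finally show "\<phi> x + T y \<in> cball x1 s" by (simp add: dist_norm)
        qed
        show "dist (\<phi> x + T y) (\<phi> x' + T y) \<le> 1 / 2 * dist x x'"
          if "x \<in> cball x1 s" "x' \<in> cball x1 s" for x x'
          using \<phi>[OF subsetD[OF sV that(1)] subsetD[OF sV that(2)]] by (simp add: dist_norm)
      qed (use \<open>s > 0\<close> in auto)
      then obtain x where x: "x \<in> cball x1 s" "\<phi> x + T y = x" by blast
      then have "T (f x) = T y" by (simp add: \<phi>_def)
      then have "f x = y" by (metis f'T)
      then show ?thesis using x s by blast
    qed
    then show "\<exists>e>0. ball y1 e \<subseteq> f ` W"
      using \<open>s > 0\<close> \<open>K > 0\<close> by (intro exI[of _ "s / (2 * K)"]) auto
  qed
  define g where "g = inv_into V f"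
  have open_fV: "open (f ` V)" using open_map V by blast
  have g: "g y \<in> V" "f (g y) = y" if "y \<in> f ` V" for y
    using that by (auto simp: g_def inv_into_into f_inv_into_f)
  have gf: "g (f x) = x" if "x \<in> V" for x
    using inj that by (simp add: g_def)
  have "norm (g y - g y') \<le> 2 * K * norm (y - y')" if "y \<in> f ` V" "y' \<in> f ` V" for y y'
    using expand[OF g(1)[OF that(1)] g(1)[OF that(2)]] K[of "y - y'"] that
    by (simp add: g T.diff mult_ac)
  then have "(2 * K)-lipschitz_on (f ` V) g"
    using \<open>K > 0\<close> by (intro lipschitz_onI) (auto simp: dist_norm)
  then have cont_g: "continuous_on (f ` V) g" by (rule lipschitz_on_continuous_on)

  have TD_norm: "norm v \<le> 2 * norm (T (D x v))" if "x \<in> V" for x v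
    using TD[OF that, of v] norm_triangle_sub[of v "T (D x v)"] by simp
  have "\<exists>L. linear L \<and> L \<circ> D x = id" if "x \<in> V" for x
  proof (rule linear_injective_left_inverse)
    show lin: "linear (D x)" using D that V has_derivative_linear by blast
    show "inj (D x)"
      unfolding linear_injective_0[OF lin] using TD_norm[OF that] T.zero
      by (metis mult_zero_right norm_le_zero_iff norm_zero)
  qed
  then obtain L where linL: "\<And>x. x \<in> V \<Longrightarrow> linear (L x)"
    and LD: "\<And>x. x \<in> V \<Longrightarrow> L x \<circ> D x = id"
    by metis
  have g_deriv: "(g has_derivative L (g y)) (at y)" if "y \<in> f ` V" for y
  proof (rule has_derivative_inverse_basic[OF _ _ _ _ open_fV that])
    show "(f has_derivative D (g y)) (at (g y))" using D g that V by blast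
    show "bounded_linear (L (g y))"
      using bounded_linear_parseval_frame[OF C] linL g that by blast
    show "L (g y) \<circ> D (g y) = id" using LD g that by blast
    show "isCont g y" using cont_g open_fV that continuous_on_eq_continuous_at by blast
  qed (use g in auto)
  \<comment> \<open>So far \<open>L x\<close> is only a left inverse of \<open>D x\<close>, obtained
    from injectivity. Differentiating f (g y) = y on the open image gives the other side.\<close>
  have DL: "D x (L x v) = v" if "x \<in> V" for x v
  proof -
    have "(f \<circ> g has_derivative D x \<circ> L x) (at (f x))"
      using diff_chain_at[OF g_deriv[of "f x"], of f "D x"] D that V gf by auto
    then have "((\<lambda>y. y) has_derivative D x \<circ> L x) (at (f x))"
      by (rule has_derivative_transform_within_open[OF _ open_fV]) (use g that in auto)
    then have "D x \<circ> L x = (\<lambda>y. y)"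
      using has_derivative_unique has_derivative_ident by blast
    then show ?thesis by (metis comp_apply)
  qed
  have smooth_L: "smooth_on V (\<lambda>x. L x v)" for v
    unfolding smooth_on_def
  proof
    fix k
    show "Ck_on k V (\<lambda>x. L x v)"
    proof (rule Ck_on_inverse_family[OF B C \<open>open V\<close>])
      show "linear (D x)" if "x \<in> V" for x using D that V has_derivative_linear by blast
      show "L x (D x v) = v" if "x \<in> V" for x v using LD[OF that] by (metis comp_apply id_apply)
      show "norm (L x v) \<le> (2 * K) * norm v" if "x \<in> V" for x v
        using TD_norm[OF that, of "L x v"] K[of v] by (simp add: DL that mult_ac)
      show "Ck_on k V (\<lambda>x. D x v)" for v
        using smooth_on_subset[OF smooth_on_frechet_derivative[OF f] \<open>V \<subseteq> U\<close>]
        by (simp add: D_def smooth_on_def)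
    qed (use linL DL in auto)
  qed
  \<comment> \<open>Bootstrapping: if \<open>g\<close> has order k, so does its derivative
    \<open>L (g y)\<close>, hence \<open>g\<close> has order k + 1.\<close>
  have "Ck_on k (f ` V) g" for k
  proof (induction k)
    case 0 then show ?case using cont_g by simp
  next
    case (Suc k)
    show ?case
    proof (rule Ck_on_SucI[OF open_fV g_deriv])
      show "Ck_on k (f ` V) (\<lambda>y. L (g y) v)" for v
        by (rule Ck_on_compose[OF B open_fV _ Suc.IH, where T = V])
          (use smooth_L g in \<open>auto simp: smooth_on_def\<close>)
    qed
  qed
  then have "smooth_on (f ` V) (inv_into V f)"
    by (simp add: smooth_on_def g_def)
  then show thesis using that[OF V(1,3,4) inj open_fV] by blast
qed

section \<open>Manifolds and their charts\<close>

text \<open>The part of \<open>smooth_manifold\<close> that concerns charts; the inverse function theorem needs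
  no more, and for the tangent bundle it avoids the Hausdorff and countability axioms.\<close>

definition compatible_charts :: "('a, 'e::real_inner) manifold \<Rightarrow> bool" where
  "compatible_charts M \<longleftrightarrow>
     (\<forall>c\<in>atlas M. openin (mtop M) (dom_chart c) \<and> inj_on (coord c) (dom_chart c) \<and>
        (\<forall>Q\<subseteq>dom_chart c. openin (mtop M) Q \<longleftrightarrow> open (coord c ` Q))) \<and>
     (\<forall>c\<in>atlas M. \<forall>d\<in>atlas M.
        smooth_on (coord c ` (dom_chart c \<inter> dom_chart d)) (coord d \<circ> param c))"

lemma param_coord: "inj_on (coord c) (dom_chart c) \<Longrightarrow> p \<in> dom_chart c \<Longrightarrow> param c (coord c p) = p"
  by (simp add: param_def)

lemma coord_param: "z \<in> coord c ` dom_chart c \<Longrightarrow> coord c (param c z) = z"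
  by (simp add: param_def f_inv_into_f)

context
  fixes M :: "('a, 'e::real_inner) manifold"
  assumes M: "compatible_charts M"
begin

lemma openin_dom_chart: "c \<in> atlas M \<Longrightarrow> openin (mtop M) (dom_chart c)"
  using M unfolding compatible_charts_def by blast

lemma inj_on_coord: "c \<in> atlas M \<Longrightarrow> inj_on (coord c) (dom_chart c)"
  using M unfolding compatible_charts_def by blast

lemma openin_iff_open_coord:
  "c \<in> atlas M \<Longrightarrow> Q \<subseteq> dom_chart c \<Longrightarrow> openin (mtop M) Q \<longleftrightarrow> open (coord c ` Q)"
  using M by (simp add: compatible_charts_def)

lemma smooth_on_transition:
  "c \<in> atlas M \<Longrightarrow> d \<in> atlas M \<Longrightarrow>
    smooth_on (coord c ` (dom_chart c \<inter> dom_chart d)) (coord d \<circ> param c)"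
  using M by (simp add: compatible_charts_def)

lemma open_coord_image: "c \<in> atlas M \<Longrightarrow> openin (mtop M) Q \<Longrightarrow> open (coord c ` (dom_chart c \<inter> Q))"
  using openin_iff_open_coord[of c "dom_chart c \<inter> Q"] openin_dom_chart by blast

lemma openin_coord_vimage:
  assumes c: "c \<in> atlas M" and "open W"
  shows "openin (mtop M) {p \<in> dom_chart c. coord c p \<in> W}"
proof -
  have "coord c ` {p \<in> dom_chart c. coord c p \<in> W} = coord c ` (dom_chart c \<inter> dom_chart c) \<inter> W"
    by auto
  moreover have "open \<dots>"
    using \<open>open W\<close> by (intro open_Int open_coord_image openin_dom_chart c)
  ultimately show ?thesis
    using openin_iff_open_coord[OF c, of "{p \<in> dom_chart c. coord c p \<in> W}"] by auto
qed

end

section \<open>Smooth maps between manifolds and their local inverses\<close>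

lemma openin_vimage_smooth_map:
  assumes "smooth_map M N U F" and "openin (mtop N) Q"
  shows "openin (mtop M) {p \<in> U. F p \<in> Q}"
proof -
  have U: "openin (mtop M) U" and "continuous_map (subtopology (mtop M) U) (mtop N) F"
    using assms(1) by (auto simp: smooth_map_def)
  then have "openin (subtopology (mtop M) U) {p \<in> topspace (subtopology (mtop M) U). F p \<in> Q}"
    using assms(2) openin_continuous_map_preimage by blast
  moreover have "topspace (subtopology (mtop M) U) = U"
    using openin_subset[OF U] by auto
  ultimately have "openin (subtopology (mtop M) U) {p \<in> U. F p \<in> Q}"
    by (simp only:)
  then show ?thesis
    using openin_open_subtopology[OF U] by blast
qed

lemma smooth_map_subset:
  assumes "smooth_map M N U F" and "openin (mtop M) V" and "V \<subseteq> U"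
  shows "smooth_map M N V F"
  unfolding smooth_map_def
proof (intro conjI ballI)
  show "continuous_map (subtopology (mtop M) V) (mtop N) F"
    using assms unfolding smooth_map_def by (blast intro: continuous_map_from_subtopology_mono)
  fix c d assume "c \<in> atlas M" "d \<in> atlas N"
  then have "smooth_on (coord c ` {p \<in> U \<inter> dom_chart c. F p \<in> dom_chart d}) (coord d \<circ> F \<circ> param c)"
    using assms(1) by (simp add: smooth_map_def)
  then show "smooth_on (coord c ` {p \<in> V \<inter> dom_chart c. F p \<in> dom_chart d}) (coord d \<circ> F \<circ> param c)"
    by (rule smooth_on_subset) (use assms(3) in blast)
qed (fact assms)

text \<open>In the charts \<open>c\<close> and \<open>d\<close> this is
  \<open>smooth_inverse_function\<close>. What remains is to carry the inverse back to the manifolds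
  and to test its smoothness in arbitrary charts, which is a matter of transition maps.\<close>

theorem manifold_inverse_function:
  fixes M :: "('a, 'e::real_inner) manifold" and N :: "('b, 'f::real_inner) manifold"
  assumes B: "parseval_frame (B::'e set)" and C: "parseval_frame (C::'f set)"
    and M: "compatible_charts M" and N: "compatible_charts N"
    and F: "smooth_map M N U F" and p: "p \<in> U"
    and c: "c \<in> charts_at M p" and d: "d \<in> charts_at N (F p)"
    and f': "(coord d \<circ> F \<circ> param c has_derivative f') (at (coord c p))"
    and T: "bounded_linear T" "\<And>v. T (f' v) = v" "\<And>v. f' (T v) = v"
  obtains V W where "p \<in> V" "V \<subseteq> U" "diffeomorphism_on M N V W F"
proof -
  have ca: "c \<in> atlas M" "p \<in> dom_chart c" and da: "d \<in> atlas N" "F p \<in> dom_chart d"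
    using c d by (auto simp: charts_at_def)
  note inj_c = inj_on_coord[OF M ca(1)] and inj_d = inj_on_coord[OF N da(1)]
  define f where "f = coord d \<circ> F \<circ> param c"
  define Q where "Q = {q \<in> U \<inter> dom_chart c. F q \<in> dom_chart d}"
  have Q_eq: "Q = dom_chart c \<inter> {q \<in> U. F q \<in> dom_chart d}" by (auto simp: Q_def)
  have "open (coord c ` Q)"
    unfolding Q_eq using F da openin_dom_chart[OF N]
    by (intro open_coord_image[OF M ca(1)] openin_vimage_smooth_map[OF F]) auto
  moreover have "smooth_on (coord c ` Q) f"
    using F ca da by (simp add: smooth_map_def Q_def f_def)
  moreover have "coord c p \<in> coord c ` Q" using p ca da by (auto simp: Q_def)
  ultimately obtain V0 where V0: "open V0" "coord c p \<in> V0" "V0 \<subseteq> coord c ` Q" "inj_on f V0"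
      "open (f ` V0)" and g: "smooth_on (f ` V0) (inv_into V0 f)"
    using smooth_inverse_function[OF B C _ _ _ f'[folded f_def] T] by metis
  define V W where "V = {q \<in> dom_chart c. coord c q \<in> V0}" and "W = F ` V"
  define g G where "g = inv_into V0 f" and "G = inv_into V F"
  have V_Q: "V \<subseteq> Q"
    using V0(3) inj_c by (auto simp: V_def Q_def inj_on_def)
  have f_coord: "f (coord c q) = coord d (F q)" if "q \<in> dom_chart c" for q
    using that inj_c by (simp add: f_def param_coord)
  have coord_V: "coord c ` V = V0"
    using V0(3) by (auto simp: V_def Q_def)
  have W_dom: "W \<subseteq> dom_chart d" using V_Q by (auto simp: W_def Q_def)
  have "coord d ` W = f ` coord c ` V"
    unfolding W_def image_image by (rule image_cong) (auto simp: V_def f_coord)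
  then have coord_W: "coord d ` W = f ` V0" by (simp add: coord_V)
  have open_V: "openin (mtop M) V"
    unfolding V_def by (rule openin_coord_vimage[OF M ca(1) V0(1)])
  have open_W: "openin (mtop N) W"
    using openin_iff_open_coord[OF N da(1) W_dom] V0(5) coord_W by simp
  have g_coord: "g (coord d (F q)) = coord c q" if "q \<in> V" for q
    using that V0(4) f_coord[of q] inv_into_f_f[OF V0(4), of "coord c q"] by (simp add: V_def g_def)
  have inj_F: "inj_on F V"
  proof (rule inj_onI)
    fix q q' assume "q \<in> V" "q' \<in> V" "F q = F q'"
    then have "coord c q = coord c q'" using g_coord by metis
    then show "q = q'" using inj_c \<open>q \<in> V\<close> \<open>q' \<in> V\<close> by (auto simp: V_def dest: inj_onD)
  qed
  have G_V: "G r \<in> V" and F_G: "F (G r) = r" if "r \<in> W" for r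
    using that by (auto simp: G_def W_def inv_into_into f_inv_into_f)
  have coord_G: "coord c (G r) = g (coord d r)" if "r \<in> W" for r
    using g_coord[OF G_V] F_G that by metis
  have G_eq: "G r = param c (g (coord d r))" if "r \<in> W" for r
    using coord_G[OF that] param_coord[OF inj_c, of "G r"] G_V[OF that] by (simp add: V_def)
  \<comment> \<open>In coordinates \<open>G\<close> is the continuous map \<open>g\<close>, so a
    preimage under \<open>G\<close> becomes a preimage under \<open>g\<close>. This serves both the
    continuity of \<open>G\<close> and the openness of the sets \<open>S\<close> on which its
    smoothness is tested.\<close>
  have preimage_G: "openin (mtop N) {r \<in> W. G r \<in> Q'}" if Q': "openin (mtop M) Q'" for Q'
  proof -
    have "coord d ` {r \<in> W. G r \<in> Q'} = f ` V0 \<inter> g -` coord c ` (dom_chart c \<inter> (V \<inter> Q'))"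
      (is "?L = ?R")
    proof
      show "?L \<subseteq> ?R"
      proof
        fix z assume "z \<in> ?L"
        then obtain r where r: "r \<in> W" "G r \<in> Q'" "z = coord d r" by blast
        have "G r \<in> dom_chart c \<inter> (V \<inter> Q')" using r G_V by (auto simp: V_def)
        then have "g (coord d r) \<in> coord c ` (dom_chart c \<inter> (V \<inter> Q'))"
          unfolding coord_G[OF r(1), symmetric] by (rule imageI)
        then show "z \<in> ?R" using r coord_W by blast
      qed
      show "?R \<subseteq> ?L"
      proof
        fix z assume "z \<in> ?R"
        then have "z \<in> coord d ` W" "g z \<in> coord c ` (dom_chart c \<inter> (V \<inter> Q'))"
          unfolding coord_W by auto
        then obtain r q where "r \<in> W" "z = coord d r" "q \<in> V \<inter> Q'" "q \<in> dom_chart c"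
            "g z = coord c q"
          by blast
        moreover from this have "G r = q"
          using G_eq param_coord[OF inj_c] by metis
        ultimately show "z \<in> ?L" by auto
      qed
    qed
    moreover have "open \<dots>"
      using smooth_on_imp_continuous_on[OF g, folded g_def] V0(5) open_V Q'
      by (intro continuous_open_preimage open_coord_image[OF M ca(1)]) auto
    ultimately show ?thesis
      using openin_iff_open_coord[OF N da(1), of "{r \<in> W. G r \<in> Q'}"] W_dom by auto
  qed
  have "smooth_map N M W G"
    unfolding smooth_map_def
  proof (intro conjI ballI)
    have "topspace (subtopology (mtop N) W) = W"
      using openin_subset[OF open_W] by auto
    then show "continuous_map (subtopology (mtop N) W) (mtop M) G"
      using preimage_G G_V openin_subset[OF open_V] openin_open_subtopology[OF open_W]
      by (auto simp: continuous_map_def)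
  next
    fix c' d' assume c': "c' \<in> atlas N" and d': "d' \<in> atlas M"
    note inj_c' = inj_on_coord[OF N c']
    define S where "S = coord c' ` {r \<in> W \<inter> dom_chart c'. G r \<in> dom_chart d'}"
    have "{r \<in> W \<inter> dom_chart c'. G r \<in> dom_chart d'} = dom_chart c' \<inter> {r \<in> W. G r \<in> dom_chart d'}"
      by auto
    then have open_S: "open S"
      unfolding S_def using d' open_coord_image[OF N c' preimage_G] openin_dom_chart[OF M] by simp
    have S: "param c' z \<in> W" "param c' z \<in> dom_chart c'" "G (param c' z) \<in> dom_chart d'"
      "z \<in> coord c' ` (dom_chart c' \<inter> dom_chart d)" if "z \<in> S" for z
      using that W_dom by (auto simp: S_def param_coord[OF inj_c'])
    \<comment> \<open>In the charts \<open>c'\<close> and \<open>d'\<close>, \<open>G\<close> is the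
      transition from \<open>c'\<close> to \<open>d\<close>, then \<open>g\<close>, then the
      transition from \<open>c\<close> to \<open>d'\<close>.\<close>
    have "smooth_on S (\<lambda>z. (coord d' \<circ> param c) (g ((coord d \<circ> param c') z)))"
    proof (rule smooth_on_compose[OF B open_S smooth_on_transition[OF M ca(1) d']])
      show "smooth_on S (\<lambda>z. g ((coord d \<circ> param c') z))"
        by (rule smooth_on_compose[OF C open_S g[folded g_def]
              smooth_on_subset[OF smooth_on_transition[OF N c' da(1)]]])
          (use S coord_W in auto)
      show "(\<lambda>z. g ((coord d \<circ> param c') z)) ` S \<subseteq> coord c ` (dom_chart c \<inter> dom_chart d')"
      proof (rule image_subsetI)
        fix z assume z: "z \<in> S"
        have "G (param c' z) \<in> dom_chart c \<inter> dom_chart d'"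
          using S[OF z] G_V by (auto simp: V_def)
        then show "g ((coord d \<circ> param c') z) \<in> coord c ` (dom_chart c \<inter> dom_chart d')"
          unfolding comp_apply coord_G[OF S(1)[OF z], symmetric] by (rule imageI)
      qed
    qed
    then show "smooth_on (coord c' ` {r \<in> W \<inter> dom_chart c'. G r \<in> dom_chart d'}) (coord d' \<circ> G \<circ> param c')"
      unfolding S_def[symmetric] using S(1)
      by (subst smooth_on_cong[OF open_S]) (auto simp: G_eq)
  qed (fact open_W)
  moreover have "smooth_map M N V F"
    using V_Q by (intro smooth_map_subset[OF F open_V]) (auto simp: Q_def)
  ultimately have "diffeomorphism_on M N V W F"
    using inj_F by (simp add: diffeomorphism_on_def bij_betw_def W_def G_def)
  moreover have "p \<in> V" using ca V0(2) by (simp add: V_def)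
  moreover have "V \<subseteq> U" using V_Q by (auto simp: Q_def)
  ultimately show thesis by (rule that[rotated 2])
qed

section \<open>Charts of smooth manifolds and of their products\<close>

lemma openin_iff_open_image:
  assumes h: "homeomorphic_map (subtopology X D) (top_of_set (h ` D)) h"
    and D: "openin X D" and "open (h ` D)" and "Q \<subseteq> D"
  shows "openin X Q \<longleftrightarrow> open (h ` Q)"
proof -
  have "Q \<subseteq> topspace (subtopology X D)"
    using \<open>Q \<subseteq> D\<close> openin_subset[OF D] by auto
  from homeomorphic_map_openness[OF h this] show ?thesis
    using assms(3,4) openin_open_subtopology[OF D] by (auto simp: openin_open_eq)
qed

lemma smooth_manifold_imp_compatible_charts:
  assumes "smooth_manifold M"
  shows "compatible_charts M"
proof -
  have "openin (mtop M) (dom_chart c) \<and> inj_on (coord c) (dom_chart c) \<and>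
      (\<forall>Q\<subseteq>dom_chart c. openin (mtop M) Q \<longleftrightarrow> open (coord c ` Q))" if "c \<in> atlas M" for c
  proof -
    have c: "openin (mtop M) (dom_chart c)" "open (coord c ` dom_chart c)"
      "homeomorphic_map (subtopology (mtop M) (dom_chart c)) (top_of_set (coord c ` dom_chart c)) (coord c)"
      using assms that by (auto simp: smooth_manifold_def)
    have "topspace (subtopology (mtop M) (dom_chart c)) = dom_chart c"
      using openin_subset[OF c(1)] by auto
    then have "inj_on (coord c) (dom_chart c)"
      using c(3) by (simp add: homeomorphic_map_def)
    then show ?thesis using c openin_iff_open_image[OF c(3,1,2)] by blast
  qed
  then show ?thesis using assms by (simp add: compatible_charts_def smooth_manifold_def)
qed

lemma param_Times:
  assumes "inj_on (coord c) (dom_chart c)" and "inj_on (coord d) (dom_chart d)"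
    and "z \<in> coord c ` dom_chart c \<times> coord d ` dom_chart d"
  shows "param (dom_chart c \<times> dom_chart d, map_prod (coord c) (coord d)) z
    = (param c (fst z), param d (snd z))"
proof -
  obtain p q where "p \<in> dom_chart c" "q \<in> dom_chart d" "z = map_prod (coord c) (coord d) (p, q)"
    using assms(3) by auto
  then show ?thesis
    using inv_into_f_f[OF map_prod_inj_on[OF assms(1,2)], of "(p, q)"] assms(1,2)
    by (simp add: param_coord) (simp add: param_def)
qed

lemma product_chart_in_atlas:
  "c \<in> atlas M \<Longrightarrow> d \<in> atlas N \<Longrightarrow>
    (dom_chart c \<times> dom_chart d, map_prod (coord c) (coord d)) \<in> atlas (product_manifold M N)"
  unfolding product_manifold_def manifold.simps by blast

text \<open>Openness must be compared for all subsets of a product chart, not only for boxes.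
  Therefore the product of the two chart homeomorphisms is formed first; the transition maps act on
  each component separately.\<close>

lemma compatible_charts_product:
  fixes M :: "('a, 'e::real_inner) manifold" and N :: "('b, 'f::real_inner) manifold"
  assumes B: "parseval_frame (B::'e set)" and C: "parseval_frame (C::'f set)"
    and M: "smooth_manifold M" and N: "smooth_manifold N"
  shows "compatible_charts (product_manifold M N)"
proof -
  note M' = smooth_manifold_imp_compatible_charts[OF M] and N' = smooth_manifold_imp_compatible_charts[OF N]
  define ch :: "('a, 'e) chart \<Rightarrow> ('b, 'f) chart \<Rightarrow> ('a \<times> 'b, 'e \<times> 'f) chart"
    where "ch = (\<lambda>c d. (dom_chart c \<times> dom_chart d, map_prod (coord c) (coord d)))"
  have atlas: "atlas (product_manifold M N) = {ch c d |c d. c \<in> atlas M \<and> d \<in> atlas N}"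
    by (simp add: product_manifold_def ch_def)
  have top: "mtop (product_manifold M N) = prod_topology (mtop M) (mtop N)"
    by (simp add: product_manifold_def)
  have charts: "openin (prod_topology (mtop M) (mtop N)) (dom_chart (ch c d)) \<and>
      inj_on (coord (ch c d)) (dom_chart (ch c d)) \<and>
      (\<forall>Q\<subseteq>dom_chart (ch c d). openin (prod_topology (mtop M) (mtop N)) Q \<longleftrightarrow> open (coord (ch c d) ` Q))"
    if c: "c \<in> atlas M" and d: "d \<in> atlas N" for c d
  proof -
    have hc: "open (coord c ` dom_chart c)"
      "homeomorphic_map (subtopology (mtop M) (dom_chart c)) (top_of_set (coord c ` dom_chart c)) (coord c)"
      using M c by (auto simp: smooth_manifold_def)
    have hd: "open (coord d ` dom_chart d)"
      "homeomorphic_map (subtopology (mtop N) (dom_chart d)) (top_of_set (coord d ` dom_chart d)) (coord d)"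
      using N d by (auto simp: smooth_manifold_def)
    have op: "openin (prod_topology (mtop M) (mtop N)) (dom_chart c \<times> dom_chart d)"
      using openin_dom_chart[OF M' c] openin_dom_chart[OF N' d] by (simp add: openin_prod_Times_iff)
    have image: "map_prod (coord c) (coord d) ` (dom_chart c \<times> dom_chart d)
        = (coord c ` dom_chart c) \<times> (coord d ` dom_chart d)"
      by (simp add: map_prod_surj_on)
    obtain gc gd where
      "homeomorphic_maps (subtopology (mtop M) (dom_chart c)) (top_of_set (coord c ` dom_chart c)) (coord c) gc"
      "homeomorphic_maps (subtopology (mtop N) (dom_chart d)) (top_of_set (coord d ` dom_chart d)) (coord d) gd"
      using hc hd by (auto simp: homeomorphic_map_maps)
    then have "homeomorphic_map
        (prod_topology (subtopology (mtop M) (dom_chart c)) (subtopology (mtop N) (dom_chart d)))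
        (prod_topology (top_of_set (coord c ` dom_chart c)) (top_of_set (coord d ` dom_chart d)))
        (\<lambda>(x, y). (coord c x, coord d y))"
      using homeomorphic_maps_prod homeomorphic_map_maps by metis
    then have "homeomorphic_map
        (subtopology (prod_topology (mtop M) (mtop N)) (dom_chart c \<times> dom_chart d))
        (top_of_set (map_prod (coord c) (coord d) ` (dom_chart c \<times> dom_chart d)))
        (map_prod (coord c) (coord d))"
      unfolding image by (simp add: map_prod_def flip: subtopology_Times)
    from openin_iff_open_image[OF this op] show ?thesis
      using op image hc(1) hd(1) map_prod_inj_on[OF inj_on_coord[OF M' c] inj_on_coord[OF N' d]]
      by (simp add: ch_def open_Times)
  qed
  have transitions: "smooth_on (coord (ch c d) ` (dom_chart (ch c d) \<inter> dom_chart (ch c' d')))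
      (coord (ch c' d') \<circ> param (ch c d))"
    if c: "c \<in> atlas M" "c' \<in> atlas M" and d: "d \<in> atlas N" "d' \<in> atlas N" for c d c' d'
  proof -
    define S1 S2 where "S1 = coord c ` (dom_chart c \<inter> dom_chart c')"
      and "S2 = coord d ` (dom_chart d \<inter> dom_chart d')"
    have S: "coord (ch c d) ` (dom_chart (ch c d) \<inter> dom_chart (ch c' d')) = S1 \<times> S2"
      by (auto simp: ch_def S1_def S2_def)
    have "open S1" "open S2"
      using open_coord_image[OF M' c(1) openin_dom_chart[OF M' c(2)]]
        open_coord_image[OF N' d(1) openin_dom_chart[OF N' d(2)]]
      by (auto simp: S1_def S2_def)
    then have open_S: "open (S1 \<times> S2)" by (rule open_Times)
    have "smooth_on (S1 \<times> S2) (\<lambda>z. ((coord c' \<circ> param c) (fst z), (coord d' \<circ> param d) (snd z)))"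
      by (intro smooth_on_Pair open_S
          smooth_on_compose[OF B open_S smooth_on_transition[OF M' c]]
          smooth_on_compose[OF C open_S smooth_on_transition[OF N' d]]
          smooth_on_bounded_linear bounded_linear_fst bounded_linear_snd)
        (auto simp: S1_def S2_def)
    moreover have "(coord (ch c' d') \<circ> param (ch c d)) z
        = ((coord c' \<circ> param c) (fst z), (coord d' \<circ> param d) (snd z))" if "z \<in> S1 \<times> S2" for z
    proof -
      have "z \<in> coord c ` dom_chart c \<times> coord d ` dom_chart d"
        using that by (auto simp: S1_def S2_def)
      then show ?thesis
        using param_Times[OF inj_on_coord[OF M' c(1)] inj_on_coord[OF N' d(1)]] by (simp add: ch_def)
    qed
    ultimately show ?thesis
      unfolding S by (subst smooth_on_cong[OF open_S])
  qed
  show ?thesis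
    unfolding compatible_charts_def top
  proof (rule conjI; intro ballI)
    fix k assume "k \<in> atlas (product_manifold M N)"
    then obtain c d where k: "k = ch c d" "c \<in> atlas M" "d \<in> atlas N" unfolding atlas by blast
    show "openin (prod_topology (mtop M) (mtop N)) (dom_chart k) \<and> inj_on (coord k) (dom_chart k) \<and>
        (\<forall>Q\<subseteq>dom_chart k. openin (prod_topology (mtop M) (mtop N)) Q \<longleftrightarrow> open (coord k ` Q))"
      unfolding k(1) by (rule charts[OF k(2,3)])
    fix k' assume "k' \<in> atlas (product_manifold M N)"
    then obtain c' d' where k': "k' = ch c' d'" "c' \<in> atlas M" "d' \<in> atlas N" unfolding atlas by blast
    show "smooth_on (coord k ` (dom_chart k \<inter> dom_chart k')) (coord k' \<circ> param k)"
      unfolding k(1) k'(1) by (rule transitions[OF k(2) k'(2) k(3) k'(3)])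
  qed
qed

section \<open>The tangent bundle\<close>

text \<open>\<open>atlas_topology\<close> is known only through generators, so openness of chart
  images goes by induction on how an open set is generated: continuity of the transition maps
  settles the generators, injectivity of the coordinates the intersections.\<close>

lemma compatible_charts_atlas_topology:
  assumes inj: "\<And>c. c \<in> A \<Longrightarrow> inj_on (coord c) (dom_chart c)"
    and overlap: "\<And>c d. c \<in> A \<Longrightarrow> d \<in> A \<Longrightarrow> open (coord c ` (dom_chart c \<inter> dom_chart d))"
    and smooth: "\<And>c d. c \<in> A \<Longrightarrow> d \<in> A \<Longrightarrow>
      smooth_on (coord c ` (dom_chart c \<inter> dom_chart d)) (coord d \<circ> param c)"
  shows "compatible_charts \<lparr>mtop = atlas_topology A, atlas = A\<rparr>"
proof -
  have vimage: "openin (atlas_topology A) {p \<in> dom_chart c. coord c p \<in> W}" if "c \<in> A" "open W" for c W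
    unfolding atlas_topology_def using that by (intro topology_generated_by_Basis) blast
  have image: "open (coord c ` (dom_chart c \<inter> Q))" if "openin (atlas_topology A) Q" "c \<in> A" for c Q
    using that(1) unfolding atlas_topology_def openin_topology_generated_by_iff
  proof induction
    case Empty then show ?case by simp
  next
    case (Int Q R)
    have "coord c ` (dom_chart c \<inter> (Q \<inter> R)) = coord c ` (dom_chart c \<inter> Q) \<inter> coord c ` (dom_chart c \<inter> R)"
      using inj[OF \<open>c \<in> A\<close>] by (auto dest: inj_onD)
    then show ?case using Int.IH by (simp only: open_Int)
  next
    case (UN K)
    have "coord c ` (dom_chart c \<inter> \<Union>K) = (\<Union>Q\<in>K. coord c ` (dom_chart c \<inter> Q))" by blast
    then show ?case using UN.IH by auto
  next
    case (Basis Q)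
    then obtain d W where d: "d \<in> A" "open W" "Q = {p \<in> dom_chart d. coord d p \<in> W}" by blast
    have "coord c ` (dom_chart c \<inter> Q)
        = coord c ` (dom_chart c \<inter> dom_chart d) \<inter> (coord d \<circ> param c) -` W"
      using param_coord[OF inj[OF \<open>c \<in> A\<close>]] by (auto simp: d(3))
    moreover have "open \<dots>"
      using smooth[OF \<open>c \<in> A\<close> d(1)] overlap[OF \<open>c \<in> A\<close> d(1)] d(2)
      by (intro continuous_open_preimage smooth_on_imp_continuous_on)
    ultimately show ?case by simp
  qed
  have "openin (atlas_topology A) (dom_chart c)" if "c \<in> A" for c
    using vimage[OF that open_UNIV] by simp
  moreover have "openin (atlas_topology A) Q \<longleftrightarrow> open (coord c ` Q)" if "c \<in> A" "Q \<subseteq> dom_chart c" for c Q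
  proof
    assume "openin (atlas_topology A) Q"
    then show "open (coord c ` Q)" using image[of Q c] that by (simp add: Int_absorb1)
  next
    assume "open (coord c ` Q)"
    moreover have "{p \<in> dom_chart c. coord c p \<in> coord c ` Q} = Q"
      using that inj[of c] by (auto dest: inj_onD)
    ultimately show "openin (atlas_topology A) Q" using vimage[OF that(1)] by metis
  qed
  ultimately show ?thesis using inj smooth by (simp add: compatible_charts_def)
qed

section \<open>Tangent vectors in coordinates and the charts of the bundle\<close>

text \<open>For a chart \<open>c\<close> at \<open>p\<close>, this is the inverse of the map
  \<open>\<lambda>v. v c\<close> on the tangent space at \<open>p\<close>.\<close>

definition tvec_of :: "('a, 'e::real_inner) manifold \<Rightarrow> 'a \<Rightarrow> ('a, 'e) chart \<Rightarrow> 'e \<Rightarrow> ('a, 'e) tvec" where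
  "tvec_of M p c e = (\<lambda>d. if d \<in> charts_at M p
     then frechet_derivative (coord d \<circ> param c) (at (coord c p)) e else 0)"

definition tangent_chart ::
    "('a, 'e::real_inner) manifold \<Rightarrow> ('a, 'e) chart \<Rightarrow> ('a \<times> ('a, 'e) tvec, 'e \<times> 'e) chart" where
  "tangent_chart M c = (Sigma (dom_chart c) (tangent_space M), \<lambda>(p, v). (coord c p, v c))"

lemma tangent_bundle_eq:
  "tangent_bundle M = \<lparr>mtop = atlas_topology (tangent_chart M ` atlas M), atlas = tangent_chart M ` atlas M\<rparr>"
proof -
  have "{(Sigma (dom_chart c) (tangent_space M), \<lambda>(p, v). (coord c p, v c)) |c. c \<in> atlas M}
      = tangent_chart M ` atlas M"
    unfolding Setcompr_eq_image by (rule image_cong) (simp_all add: tangent_chart_def)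
  then show ?thesis by (simp add: tangent_bundle_def Let_def)
qed

context
  fixes M :: "('a, 'e::real_inner) manifold"
  assumes M: "compatible_charts M"
begin

lemma transition_has_derivative:
  assumes "c \<in> charts_at M p" and "d \<in> charts_at M p"
  shows "(coord d \<circ> param c has_derivative frechet_derivative (coord d \<circ> param c) (at (coord c p)))
    (at (coord c p))"
  using assms by (intro smooth_on_imp_has_derivative[OF smooth_on_transition[OF M]])
    (auto simp: charts_at_def)

lemma transition_derivative_self:
  assumes c: "c \<in> charts_at M p"
  shows "frechet_derivative (coord c \<circ> param c) (at (coord c p)) e = e"
proof -
  have ca: "c \<in> atlas M" "p \<in> dom_chart c" using c by (auto simp: charts_at_def)
  have "((\<lambda>z. z) has_derivative frechet_derivative (coord c \<circ> param c) (at (coord c p))) (at (coord c p))"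
    by (rule has_derivative_transform_within_open[OF transition_has_derivative[OF c c]
          open_coord_image[OF M ca(1) openin_dom_chart[OF M ca(1)]]])
      (use ca in \<open>auto simp: coord_param\<close>)
  then show ?thesis
    using has_derivative_unique[OF has_derivative_ident] by metis
qed

text \<open>The cocycle rule: on the triple overlap, an open set, the two routes from
  \<open>c\<close> to \<open>k\<close> agree, and the chain rule applies. It is the reason why
  \<open>tvec_of\<close> yields tangent vectors.\<close>

lemma transition_derivative_comp:
  assumes c: "c \<in> charts_at M p" and d: "d \<in> charts_at M p" and k: "k \<in> charts_at M p"
  shows "frechet_derivative (coord k \<circ> param d) (at (coord d p))
      (frechet_derivative (coord d \<circ> param c) (at (coord c p)) e)
    = frechet_derivative (coord k \<circ> param c) (at (coord c p)) e"
proof -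
  have ca: "c \<in> atlas M" "p \<in> dom_chart c" and da: "d \<in> atlas M" "p \<in> dom_chart d"
    and ka: "k \<in> atlas M" "p \<in> dom_chart k"
    using c d k by (auto simp: charts_at_def)
  note inj = inj_on_coord[OF M ca(1)] inj_on_coord[OF M da(1)]
  define S where "S = coord c ` (dom_chart c \<inter> (dom_chart d \<inter> dom_chart k))"
  have "open S"
    unfolding S_def by (intro open_coord_image[OF M ca(1)] openin_Int openin_dom_chart[OF M] da ka)
  have "(coord d \<circ> param c) (coord c p) = coord d p"
    using param_coord[OF inj(1) ca(2)] by simp
  then have "((coord k \<circ> param d) \<circ> (coord d \<circ> param c) has_derivative
      frechet_derivative (coord k \<circ> param d) (at (coord d p)) \<circ>
      frechet_derivative (coord d \<circ> param c) (at (coord c p))) (at (coord c p))"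
    using transition_has_derivative[OF d k]
    by (intro diff_chain_at transition_has_derivative[OF c d]) simp
  then have "(coord k \<circ> param c has_derivative
      frechet_derivative (coord k \<circ> param d) (at (coord d p)) \<circ>
      frechet_derivative (coord d \<circ> param c) (at (coord c p))) (at (coord c p))"
  proof (rule has_derivative_transform_within_open[OF _ \<open>open S\<close>])
    show "coord c p \<in> S" using ca da ka by (auto simp: S_def)
    show "((coord k \<circ> param d) \<circ> (coord d \<circ> param c)) z = (coord k \<circ> param c) z" if "z \<in> S" for z
      using that by (auto simp: S_def param_coord[OF inj(1)] param_coord[OF inj(2)])
  qed
  then show ?thesis
    using has_derivative_unique[OF transition_has_derivative[OF c k]] by (metis comp_apply)
qed

lemma tvec_of_in_tangent_space: "c \<in> charts_at M p \<Longrightarrow> tvec_of M p c e \<in> tangent_space M p"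
  by (simp add: tangent_space_def tvec_of_def transition_derivative_comp)

lemma tvec_of_self: "c \<in> charts_at M p \<Longrightarrow> tvec_of M p c e c = e"
  by (simp add: tvec_of_def transition_derivative_self)

lemma tangent_space_eqI:
  assumes "v \<in> tangent_space M p" and "w \<in> tangent_space M p" and "c \<in> charts_at M p" and "v c = w c"
  shows "v = w"
proof
  fix d
  show "v d = w d"
  proof (cases "d \<in> charts_at M p")
    case True
    then have "u d = frechet_derivative (coord d \<circ> param c) (at (coord c p)) (u c)"
      if "u \<in> tangent_space M p" for u
      using that assms(3) unfolding tangent_space_def by blast
    from this[OF assms(1)] this[OF assms(2)] assms(4) show ?thesis by simp
  next
    case False
    then have "u d = 0" if "u \<in> tangent_space M p" for u
      using that unfolding tangent_space_def by blast
    from this[OF assms(1)] this[OF assms(2)] show ?thesis by simp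
  qed
qed

lemma zero_tvec_in_tangent_space: "zero_tvec \<in> tangent_space M p"
  by (simp add: tangent_space_def zero_tvec_def
      linear_0[OF has_derivative_linear[OF transition_has_derivative]])

lemma inj_on_tangent_chart:
  assumes "c \<in> atlas M"
  shows "inj_on (coord (tangent_chart M c)) (dom_chart (tangent_chart M c))"
proof (rule inj_onI)
  fix x y
  assume xy: "x \<in> dom_chart (tangent_chart M c)" "y \<in> dom_chart (tangent_chart M c)"
    "coord (tangent_chart M c) x = coord (tangent_chart M c) y"
  then have "fst x = fst y"
    using inj_onD[OF inj_on_coord[OF M assms]] by (auto simp: tangent_chart_def)
  moreover have "snd x = snd y"
    using xy \<open>fst x = fst y\<close> assms
    by (intro tangent_space_eqI[of "snd x" "fst x" _ c]) (auto simp: tangent_chart_def charts_at_def)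
  ultimately show "x = y" by (rule prod_eqI)
qed

lemma param_tangent_chart:
  assumes c: "c \<in> charts_at M p"
  shows "param (tangent_chart M c) (coord c p, e) = (p, tvec_of M p c e)"
proof -
  have "c \<in> atlas M" "(p, tvec_of M p c e) \<in> dom_chart (tangent_chart M c)"
    using c tvec_of_in_tangent_space by (auto simp: tangent_chart_def charts_at_def)
  from param_coord[OF inj_on_tangent_chart[OF this(1)] this(2)] show ?thesis
    by (simp add: tangent_chart_def tvec_of_self[OF c])
qed

text \<open>Every \<open>e\<close> is the \<open>c\<close>-component of a tangent vector, namely of
  \<open>tvec_of M p c e\<close>, so nothing restricts the second factor.\<close>

lemma tangent_chart_image:
  assumes c: "c \<in> atlas M"
  shows "coord (tangent_chart M c) ` (dom_chart (tangent_chart M c) \<inter> dom_chart (tangent_chart M d))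
    = coord c ` (dom_chart c \<inter> dom_chart d) \<times> UNIV" (is "?L = ?R")
proof
  show "?L \<subseteq> ?R" by (auto simp: tangent_chart_def)
  show "?R \<subseteq> ?L"
  proof
    fix z assume "z \<in> ?R"
    then obtain p where p: "p \<in> dom_chart c" "p \<in> dom_chart d" "fst z = coord c p" by auto
    then have "c \<in> charts_at M p" using c by (simp add: charts_at_def)
    then have "z = coord (tangent_chart M c) (p, tvec_of M p c (snd z))"
      "(p, tvec_of M p c (snd z)) \<in> dom_chart (tangent_chart M c) \<inter> dom_chart (tangent_chart M d)"
      using p tvec_of_self tvec_of_in_tangent_space by (auto simp: tangent_chart_def prod_eq_iff)
    then show "z \<in> ?L" by blast
  qed
qed

text \<open>The transition maps are (y, e) |-> (\<open>\<tau>\<close> y, D\<open>\<tau>\<close> y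
  e). Joint smoothness of the second component comes from expanding e in the frame: it is a finite
  sum of a linear function of e times a smooth function of y.\<close>

lemma compatible_charts_tangent_bundle:
  assumes B: "parseval_frame (B::'e set)"
  shows "compatible_charts (tangent_bundle M)"
  unfolding tangent_bundle_eq
proof (rule compatible_charts_atlas_topology)
  show "inj_on (coord k) (dom_chart k)" if "k \<in> tangent_chart M ` atlas M" for k
    using that inj_on_tangent_chart by blast
  fix k l assume "k \<in> tangent_chart M ` atlas M" "l \<in> tangent_chart M ` atlas M"
  then obtain c d where k: "k = tangent_chart M c" and c: "c \<in> atlas M"
    and l: "l = tangent_chart M d" and d: "d \<in> atlas M" by blast
  define S where "S = coord c ` (dom_chart c \<inter> dom_chart d)"
  have image: "coord k ` (dom_chart k \<inter> dom_chart l) = S \<times> UNIV"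
    unfolding k l S_def by (rule tangent_chart_image[OF c])
  have "open S"
    unfolding S_def by (rule open_coord_image[OF M c openin_dom_chart[OF M d]])
  then have open_S: "open (S \<times> (UNIV :: 'e set))" by (intro open_Times open_UNIV)
  then show "open (coord k ` (dom_chart k \<inter> dom_chart l))" by (simp add: image)
  define \<tau> where "\<tau> = coord d \<circ> param c"
  have \<tau>: "smooth_on S \<tau>" unfolding S_def \<tau>_def by (rule smooth_on_transition[OF M c d])
  have fst: "smooth_on (S \<times> (UNIV :: 'e set)) fst" and snd: "smooth_on (S \<times> (UNIV :: 'e set)) snd"
    using open_S by (auto intro: smooth_on_bounded_linear bounded_linear_fst bounded_linear_snd)
  have inner: "smooth_on UNIV (\<lambda>e::'e. e \<bullet> b)" for b
    by (intro smooth_on_bounded_linear open_UNIV bounded_linear_inner_left)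
  have "smooth_on (S \<times> UNIV)
      (\<lambda>z. (\<tau> (fst z), \<Sum>b\<in>B. (snd z \<bullet> b) *\<^sub>R frechet_derivative \<tau> (at (fst z)) b))"
    using smooth_on_compose[OF B open_S \<tau> fst] smooth_on_compose[OF B open_S inner snd]
      smooth_on_compose[OF B open_S smooth_on_frechet_derivative[OF \<tau>] fst]
    by (intro smooth_on_Pair smooth_on_sum smooth_on_scaleR open_S) auto
  moreover have "(coord l \<circ> param k) z
      = (\<tau> (fst z), \<Sum>b\<in>B. (snd z \<bullet> b) *\<^sub>R frechet_derivative \<tau> (at (fst z)) b)"
    if "z \<in> S \<times> UNIV" for z
  proof -
    have "fst z \<in> coord c ` (dom_chart c \<inter> dom_chart d)"
      using that by (simp add: S_def mem_Times_iff)
    then obtain p where p: "p \<in> dom_chart c" "p \<in> dom_chart d" "fst z = coord c p" by blast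
    then have cp: "c \<in> charts_at M p" "d \<in> charts_at M p" using c d by (auto simp: charts_at_def)
    have "(coord l \<circ> param k) z = (coord d p, frechet_derivative \<tau> (at (fst z)) (snd z))"
      using param_tangent_chart[OF cp(1), of "snd z"] cp(2) p(3)
      by (cases z) (simp add: k l tangent_chart_def tvec_of_def \<tau>_def)
    moreover have "linear (frechet_derivative \<tau> (at (fst z)))"
      using has_derivative_linear[OF transition_has_derivative[OF cp]] p by (simp add: \<tau>_def)
    moreover have "\<tau> (fst z) = coord d p"
      using p param_coord[OF inj_on_coord[OF M c]] by (simp add: \<tau>_def)
    ultimately show ?thesis
      using linear_parseval_frame[OF B] by auto
  qed
  ultimately show "smooth_on (coord k ` (dom_chart k \<inter> dom_chart l)) (coord l \<circ> param k)"
    unfolding image by (subst smooth_on_cong[OF open_S])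
qed

end

section \<open>Discretization maps\<close>

text \<open>The chart of \<open>T\<^sub>xM\<close> that \<open>tangent_map\<close> picks comes from some chart \<open>c\<close> of \<open>M\<close> at \<open>x\<close>;
  reading everything in this \<open>c\<close> avoids a change of charts.\<close>

lemma discretization_map_derivative:
  fixes M :: "('a, 'e::real_inner) manifold"
  assumes M: "smooth_manifold M" and R: "discretization_map M U R" and x: "x \<in> points M"
  obtains c f' where "c \<in> charts_at M x"
    and "(map_prod (coord c) (coord c) \<circ> R \<circ> param (tangent_chart M c) has_derivative f') (at (coord c x, 0))"
    and "\<And>h. f' (h, 0) = (h, h)" and "\<And>k. snd (f' (0, k)) - fst (f' (0, k)) = k"
proof -
  note M' = smooth_manifold_imp_compatible_charts[OF M]
  have zero_U: "(y, zero_tvec) \<in> U" and R_zero: "R (y, zero_tvec) = (y, y)" if "y \<in> points M" for y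
    using R that by (auto simp: discretization_map_def zero_section_def)
  define X where "X = tangent_space_manifold M x"
  define \<kappa> where "\<kappa> = (SOME k. k \<in> charts_at X zero_tvec)"
  have charts_X: "charts_at X zero_tvec = {(tangent_space M x, \<lambda>v. v c) |c. c \<in> charts_at M x}"
    using zero_tvec_in_tangent_space[OF M']
    by (auto simp: X_def tangent_space_manifold_def charts_at_def Let_def)
  have "x \<in> (\<Union>c\<in>atlas M. dom_chart c)"
    using M x by (simp add: smooth_manifold_def)
  then obtain c0 where "c0 \<in> charts_at M x"
    unfolding charts_at_def by blast
  then have "charts_at X zero_tvec \<noteq> {}" unfolding charts_X by blast
  then have \<kappa>: "\<kappa> \<in> charts_at X zero_tvec" unfolding \<kappa>_def by (rule some_in_eq[THEN iffD2])
  then obtain c where c: "c \<in> charts_at M x" and \<kappa>_eq: "\<kappa> = (tangent_space M x, \<lambda>v. v c)"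
    unfolding charts_X by blast
  have ca: "c \<in> atlas M" "x \<in> dom_chart c" using c by (auto simp: charts_at_def)
  define f where "f = map_prod (coord c) (coord c) \<circ> R \<circ> param (tangent_chart M c)"
  define f' where "f' = frechet_derivative f (at (coord c x, 0))"
  have f_coord: "f (coord c p, e) = map_prod (coord c) (coord c) (R (p, tvec_of M p c e))"
    if "p \<in> dom_chart c" for p e
    using that ca param_tangent_chart[OF M', of c p e] by (simp add: f_def charts_at_def)
  \<comment> \<open>Fibre coordinate 0 means the zero vector over every point of the chart domain,
    not only over \<open>x\<close>. Hence the slice y |-> f (y, 0) is the diagonal near
    \<open>coord c x\<close> and can be differentiated.\<close>
  have tvec_zero: "tvec_of M p c 0 = zero_tvec" if "p \<in> dom_chart c" for p
    using that ca zero_tvec_in_tangent_space[OF M'] tvec_of_in_tangent_space[OF M', of c p]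
    by (intro tangent_space_eqI[OF M', of _ p _ c])
      (auto simp: charts_at_def tvec_of_self[OF M'] zero_tvec_def)
  have f': "(f has_derivative f') (at (coord c x, 0))"
  proof -
    define d where "d = (dom_chart c \<times> dom_chart c, map_prod (coord c) (coord c))"
    have "d \<in> atlas (product_manifold M M)"
      unfolding d_def by (rule product_chart_in_atlas[OF ca(1) ca(1)])
    moreover have "tangent_chart M c \<in> atlas (tangent_bundle M)"
      using ca by (simp add: tangent_bundle_eq)
    ultimately have "smooth_on (coord (tangent_chart M c) `
        {p \<in> U \<inter> dom_chart (tangent_chart M c). R p \<in> dom_chart d}) (coord d \<circ> R \<circ> param (tangent_chart M c))"
      using R by (simp add: discretization_map_def smooth_map_def)
    then have "smooth_on (coord (tangent_chart M c) `
        {p \<in> U \<inter> dom_chart (tangent_chart M c). R p \<in> dom_chart d}) f"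
      by (simp add: f_def d_def)
    moreover have "(coord c x, 0) \<in> coord (tangent_chart M c) `
        {p \<in> U \<inter> dom_chart (tangent_chart M c). R p \<in> dom_chart d}"
      using x ca zero_U R_zero zero_tvec_in_tangent_space[OF M']
      by (intro image_eqI[of _ _ "(x, zero_tvec)"]) (auto simp: tangent_chart_def d_def zero_tvec_def)
    ultimately show ?thesis unfolding f'_def by (rule smooth_on_imp_has_derivative)
  qed
  have horizontal: "f' (h, 0) = (h, h)" for h
  proof -
    have "((\<lambda>y. (y, 0)) has_derivative (\<lambda>h. (h, 0))) (at (coord c x))"
      by (intro has_derivative_Pair has_derivative_ident has_derivative_const)
    then have "(f \<circ> (\<lambda>y. (y, 0)) has_derivative f' \<circ> (\<lambda>h. (h, 0))) (at (coord c x))"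
      by (rule diff_chain_at) (rule f')
    then have "((\<lambda>y. (y, y)) has_derivative f' \<circ> (\<lambda>h. (h, 0))) (at (coord c x))"
    proof (rule has_derivative_transform_within_open)
      show "open (coord c ` (dom_chart c \<inter> dom_chart c))"
        using ca by (intro open_coord_image[OF M'] openin_dom_chart[OF M'])
      show "coord c x \<in> coord c ` (dom_chart c \<inter> dom_chart c)" using ca by blast
      fix y assume "y \<in> coord c ` (dom_chart c \<inter> dom_chart c)"
      then obtain p where p: "p \<in> dom_chart c" "y = coord c p" by blast
      moreover from p have "p \<in> points M"
        using openin_subset[OF openin_dom_chart[OF M' ca(1)]] by blast
      ultimately show "(f \<circ> (\<lambda>y. (y, 0))) y = (y, y)"
        by (simp add: f_coord tvec_zero R_zero)
    qed
    moreover have "((\<lambda>y. (y, y)) has_derivative (\<lambda>h. (h, h))) (at (coord c x))"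
      by (intro has_derivative_Pair has_derivative_ident)
    ultimately have "f' \<circ> (\<lambda>h. (h, 0)) = (\<lambda>h. (h, h))" by (rule has_derivative_unique)
    then show ?thesis by (metis comp_apply)
  qed
  have vertical: "snd (f' (0, k)) - fst (f' (0, k)) = k" for k
  proof -
    have "((\<lambda>e. (coord c x, e)) has_derivative (\<lambda>k. (0, k))) (at 0)"
      by (intro has_derivative_Pair has_derivative_ident has_derivative_const)
    then have "(f \<circ> (\<lambda>e. (coord c x, e)) has_derivative f' \<circ> (\<lambda>k. (0, k))) (at 0)"
      by (rule diff_chain_at) (rule f')
    then have deriv: "((\<lambda>e. f (coord c x, e)) has_derivative (\<lambda>k. f' (0, k))) (at 0)"
      by (simp add: o_def)
    have inj_\<kappa>: "inj_on (coord \<kappa>) (dom_chart \<kappa>)"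
      using tangent_space_eqI[OF M' _ _ c] by (auto simp: \<kappa>_eq intro: inj_onI)
    have param_\<kappa>: "param \<kappa> e = tvec_of M x c e" for e
      using param_coord[OF inj_\<kappa>, of "tvec_of M x c e"] tvec_of_in_tangent_space[OF M' c]
      by (simp add: \<kappa>_eq tvec_of_self[OF M' c])
    \<comment> \<open>Condition (2) is applied to the vector with \<open>c\<close>-component
      \<open>k\<close>, and the resulting identity is read in the chart \<open>c\<close>.\<close>
    define v where "v = tvec_of M x c k"
    have "vec_to_tangent_at_zero M x v \<kappa> = vector_derivative (\<lambda>t. t *\<^sub>R v c) (at 0)"
      using \<kappa> by (simp add: vec_to_tangent_at_zero_def flip: X_def) (simp add: \<kappa>_eq)
    also have "\<dots> = k"
      unfolding v_def tvec_of_self[OF M' c]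
      by (rule vector_derivative_at) (auto intro!: derivative_eq_intros)
    finally have vec: "vec_to_tangent_at_zero M x v \<kappa> = k" .
    \<comment> \<open>Stated for an arbitrary map \<open>F\<close> on the fibre so as to serve both
      components of \<open>R\<close>; \<open>\<kappa>\<close> is the very chart that
      \<open>tangent_map\<close> picks.\<close>
    have T: "tangent_map X M F zero_tvec (vec_to_tangent_at_zero M x v) c = L k"
      if "F zero_tvec = x" and "((coord c \<circ> F \<circ> param \<kappa>) has_derivative L) (at 0)" for F L
    proof -
      have "tangent_map X M F zero_tvec (vec_to_tangent_at_zero M x v) c
          = frechet_derivative (coord c \<circ> F \<circ> param \<kappa>) (at (coord \<kappa> zero_tvec))
              (vec_to_tangent_at_zero M x v \<kappa>)"
        using c that(1) by (simp add: tangent_map_def Let_def flip: \<kappa>_def)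
      also have "\<dots> = L k"
        using frechet_derivative_at[OF that(2)] by (simp add: vec) (simp add: \<kappa>_eq zero_tvec_def)
      finally show ?thesis .
    qed
    have "coord c \<circ> (\<lambda>w. snd (R (x, w))) \<circ> param \<kappa> = (\<lambda>e. snd (f (coord c x, e)))"
      by (simp add: fun_eq_iff param_\<kappa> f_coord[OF ca(2)])
    then have "(coord c \<circ> (\<lambda>w. snd (R (x, w))) \<circ> param \<kappa> has_derivative (\<lambda>k. snd (f' (0, k)))) (at 0)"
      using has_derivative_snd[OF deriv] by simp
    then have T_snd: "tangent_map X M (\<lambda>w. snd (R (x, w))) zero_tvec (vec_to_tangent_at_zero M x v) c
        = snd (f' (0, k))"
      by (rule T[rotated]) (simp add: R_zero[OF x])
    have "coord c \<circ> (\<lambda>w. fst (R (x, w))) \<circ> param \<kappa> = (\<lambda>e. fst (f (coord c x, e)))"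
      by (simp add: fun_eq_iff param_\<kappa> f_coord[OF ca(2)])
    then have "(coord c \<circ> (\<lambda>w. fst (R (x, w))) \<circ> param \<kappa> has_derivative (\<lambda>k. fst (f' (0, k)))) (at 0)"
      using has_derivative_fst[OF deriv] by simp
    then have T_fst: "tangent_map X M (\<lambda>w. fst (R (x, w))) zero_tvec (vec_to_tangent_at_zero M x v) c
        = fst (f' (0, k))"
      by (rule T[rotated]) (simp add: R_zero[OF x])
    have "v \<in> tangent_space M x" unfolding v_def by (rule tvec_of_in_tangent_space[OF M' c])
    then have "(\<lambda>d. tangent_map X M (\<lambda>w. snd (R (x, w))) zero_tvec (vec_to_tangent_at_zero M x v) d
        - tangent_map X M (\<lambda>w. fst (R (x, w))) zero_tvec (vec_to_tangent_at_zero M x v) d) = v"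
      using R x unfolding discretization_map_def Let_def X_def by blast
    from fun_cong[OF this, of c] show ?thesis
      by (simp add: T_snd T_fst) (simp add: v_def tvec_of_self[OF M' c])
  qed
  show thesis by (rule that[OF c f'[unfolded f_def] horizontal vertical])
qed

section \<open>Invertibility along the zero section and the resulting neighborhood\<close>

theorem proposition2p3:
  fixes M :: "('a, 'e::real_inner) manifold"
    and U :: "('a \<times> ('a, 'e) tvec) set"
    and R\<^sub>d :: "'a \<times> ('a, 'e) tvec \<Rightarrow> 'a \<times> 'a"
  assumes "smooth_manifold M"
    and "discretization_map M U R\<^sub>d"
  shows "\<exists>S. openin (mtop (tangent_bundle M)) S \<and> zero_section M \<subseteq> S \<and> S \<subseteq> U \<and>
           local_diffeomorphism_on (tangent_bundle M) (product_manifold M M) S R\<^sub>d"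
proof -
  obtain B where B: "parseval_frame (B :: 'e set)"
    using assms(1) parseval_frame_exists unfolding smooth_manifold_def by metis
  obtain BB where BB: "parseval_frame (BB :: ('e \<times> 'e) set)"
    using parseval_frame_Times[OF B B] by blast
  note M = smooth_manifold_imp_compatible_charts[OF assms(1)]
  have smooth: "smooth_map (tangent_bundle M) (product_manifold M M) U R\<^sub>d"
    using assms(2) by (simp add: discretization_map_def)
  \<comment> \<open>All sets of this kind are collected, rather than one for each point, so no
    choice of neighborhoods is made.\<close>
  define \<V> where "\<V> = {V. V \<subseteq> U \<and> (\<exists>W. diffeomorphism_on (tangent_bundle M) (product_manifold M M) V W R\<^sub>d)}"
  have cover: "\<exists>V\<in>\<V>. (x, zero_tvec) \<in> V" if x: "x \<in> points M" for x
  proof -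
    obtain c f' where c: "c \<in> charts_at M x"
      and f': "(map_prod (coord c) (coord c) \<circ> R\<^sub>d \<circ> param (tangent_chart M c) has_derivative f')
        (at (coord c x, 0))"
      and horizontal: "\<And>h. f' (h, 0) = (h, h)" and vertical: "\<And>k. snd (f' (0, k)) - fst (f' (0, k)) = k"
      by (rule discretization_map_derivative[OF assms x]) (rule that)
    have ca: "c \<in> atlas M" "x \<in> dom_chart c" using c by (auto simp: charts_at_def)
    have R_zero: "R\<^sub>d (x, zero_tvec) = (x, x)" and zero_U: "(x, zero_tvec) \<in> U"
      using assms(2) x by (auto simp: discretization_map_def zero_section_def)
    define d where "d = (dom_chart c \<times> dom_chart c, map_prod (coord c) (coord c))"
    have d: "d \<in> charts_at (product_manifold M M) (R\<^sub>d (x, zero_tvec))"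
      using ca product_chart_in_atlas[OF ca(1) ca(1)] by (simp add: d_def charts_at_def R_zero)
    have k: "tangent_chart M c \<in> charts_at (tangent_bundle M) (x, zero_tvec)"
      using ca zero_tvec_in_tangent_space[OF M]
      by (auto simp: charts_at_def tangent_bundle_eq tangent_chart_def)
    have "coord (tangent_chart M c) (x, zero_tvec) = (coord c x, 0)"
      by (simp add: tangent_chart_def zero_tvec_def)
    with f' have f'_k: "(coord d \<circ> R\<^sub>d \<circ> param (tangent_chart M c) has_derivative f')
        (at (coord (tangent_chart M c) (x, zero_tvec)))"
      by (simp add: d_def)
    interpret f': bounded_linear f' using f' by (rule has_derivative_bounded_linear)
    define A where "A = (\<lambda>k. fst (f' (0, k)))"
    have f'_eq: "f' (h, k) = (h + A k, h + A k + k)" for h k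
    proof -
      have "f' (h, k) = f' (h, 0) + f' (0, k)" by (simp flip: f'.add)
      then show ?thesis
        using vertical[of k] by (auto simp: horizontal A_def prod_eq_iff algebra_simps)
    qed
    have bl_snd_fst: "bounded_linear (\<lambda>z::'e \<times> 'e. snd z - fst z)"
      by (intro bounded_linear_sub bounded_linear_snd bounded_linear_fst)
    have "bounded_linear (\<lambda>k::'e. (0::'e, k))"
      by (intro bounded_linear_Pair bounded_linear_zero bounded_linear_ident)
    then have "bounded_linear (\<lambda>k. f' (0, k))"
      by (rule f'.bounded_linear_axioms[THEN bounded_linear_compose])
    then have "bounded_linear A"
      unfolding A_def by (rule bounded_linear_fst[THEN bounded_linear_compose])
    define T where "T = (\<lambda>z. (fst z - A (snd z - fst z), snd z - fst z))"
    have "bounded_linear T"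
      unfolding T_def
      by (intro bounded_linear_Pair bounded_linear_sub bounded_linear_fst bl_snd_fst
          bounded_linear_compose[OF \<open>bounded_linear A\<close> bl_snd_fst])
    moreover have "T (f' z) = z" "f' (T z) = z" for z
      by (cases z, simp add: T_def f'_eq)+
    ultimately obtain V W where "(x, zero_tvec) \<in> V" "V \<subseteq> U"
        "diffeomorphism_on (tangent_bundle M) (product_manifold M M) V W R\<^sub>d"
      using manifold_inverse_function[OF BB BB compatible_charts_tangent_bundle[OF M B]
          compatible_charts_product[OF B B assms(1) assms(1)] smooth zero_U k d f'_k] by metis
    then show ?thesis by (auto simp: \<V>_def)
  qed
  have "openin (mtop (tangent_bundle M)) (\<Union>\<V>)"
    by (rule openin_Union) (auto simp: \<V>_def diffeomorphism_on_def smooth_map_def)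
  moreover from this have "local_diffeomorphism_on (tangent_bundle M) (product_manifold M M) (\<Union>\<V>) R\<^sub>d"
    unfolding local_diffeomorphism_on_def \<V>_def by blast
  moreover have "zero_section M \<subseteq> \<Union>\<V>"
    using cover by (auto simp: zero_section_def)
  moreover have "\<Union>\<V> \<subseteq> U" by (auto simp: \<V>_def)
  ultimately show ?thesis by blast
qed

end
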